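(* In the model of the context let $$f(x)=(1-\theta)+(2\theta-1)(3x^2-2x^3),\qquad \theta\in(1/2,1).$$ If $3\theta-\tfrac32\le\frac{1}{1-\alpha-\beta}$, then there is a random variable of the form $\mathbf{Z}_\infty=Z_\infty\mathbf{1}$ such that, almost surely, $$\mathbf{Z}_n\longrightarrow\mathbf{Z}_\infty\qquad\text{and}\qquad\frac1n\sum_{k=1}^n\mathbf{I}_k\longrightarrow\mathbf{Z}_\infty .$$ Moreover, $\mathbf{Z}_\infty$ takes values in the set of the stable zero points of $\mathbf{F}$, which is contained in $(0,1)^N$ and consists of at most two different points.
   Context: Model. Let $N\ge 2$, $\alpha,\beta\in[0,1)$ with $\alpha+\beta\in(0,1)$, $q\in(0,1]$, and let $f:[0,1]\to[0,1]$ be the given strictly increasing $\mathcal{C}^1$ function. Let $(r_n)_{n\ge0}$ be a deterministic sequence in $[0,1]$ with $\lim_{n\to\infty} n r_n=1$. Let $Z_{0,h}$, $1\le h\le N$, be random variables with values in $[0,1]$. For $n\ge 0$ and $1\le h\le N$ set $Z_{n+1,h}=(1-r_n)Z_{n,h}+r_nI_{n+1,h}$, where the $I_{n+1,h}$ take values in $\{0,1\}$ and, given $\mathcal{F}_n=\sigma(Z_{0,h}:1\le h\le N)\vee\sigma(I_{k,h}:1\le k\le n,\,1\le h\le N)$, the variables $I_{n+1,1},\dots,I_{n+1,N}$ are conditionally independent with $$P(I_{n+1,h}=1\mid\mathcal{F}_n)=\alpha Z_n+\beta q+(1-\alpha-\beta)f(Z_{n,h}),\qquad Z_n=\frac1N\sum_{i=1}^N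 Z_{n,i}.$$ Write $\mathbf{Z}_n=(Z_{n,1},\dots,Z_{n,N})^\top$, $\mathbf{I}_n=(I_{n,1},\dots,I_{n,N})^\top$, and let $\mathbf{1}$ be the vector with all components equal to $1$. Define $\mathbf{F}=(F_1,\dots,F_N)^\top$ on $[0,1]^N$ by $$F_h(\mathbf{z})=\alpha\frac1N\sum_{i=1}^Nz_i+\beta q+(1-\alpha-\beta)f(z_h)-z_h .$$ A zero point of $\mathbf{F}$ is a $\mathbf{z}\in[0,1]^N$ with $\mathbf{F}(\mathbf{z})=\mathbf{0}$; it is stable if all eigenvalues of the Jacobian matrix of $\mathbf{F}$ at $\mathbf{z}$ (a symmetric matrix) are $\le 0$. *)

theory Defs
  imports "HOL-Probability.Probability"
begin

text \<open>Conditional independence of a family of random variables given a sub-sigma-algebra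
  \<open>G\<close> of \<open>M\<close>; the conditional analogue of \<^const>\<open>prob_space.indep_vars\<close>.\<close>

definition cond_indep_vars ::
    "'a measure \<Rightarrow> 'a measure \<Rightarrow> ('i \<Rightarrow> 'b measure) \<Rightarrow> ('i \<Rightarrow> 'a \<Rightarrow> 'b) \<Rightarrow> 'i set \<Rightarrow> bool" where
  "cond_indep_vars M G M' X H \<longleftrightarrow>
    (\<forall>i\<in>H. X i \<in> measurable M (M' i)) \<and>
    (\<forall>J\<subseteq>H. J \<noteq> {} \<longrightarrow> finite J \<longrightarrow> (\<forall>A\<in>Pi J (\<lambda>i. sets (M' i)).
      AE \<omega> in M.
        real_cond_exp M G (indicator (\<Inter>j\<in>J. X j -` A j \<inter> space M)) \<omega> =
        (\<Prod>j\<in>J. real_cond_exp M G (indicator (X j -` A j \<inter> space M)) \<omega>)))"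

text \<open>The number \<open>N\<close> of components is \<open>CARD('n)\<close>, and the components are indexed by \<open>'n\<close>.\<close>

definition mean :: "real ^ 'n::finite \<Rightarrow> real" where
  "mean z = (\<Sum>i\<in>UNIV. z $ i) / real CARD('n)"

text \<open>The sigma-algebra generated by \<open>Z 0\<close> and \<open>I 1, \<dots>, I n\<close>; the value \<open>I 0\<close> is never used.\<close>

definition history ::
    "'a measure \<Rightarrow> (nat \<Rightarrow> 'a \<Rightarrow> real ^ 'n::finite) \<Rightarrow> (nat \<Rightarrow> 'a \<Rightarrow> real ^ 'n) \<Rightarrow> nat \<Rightarrow> 'a measure" where
  "history M Z I n = sigma (space M)
     ({(\<lambda>\<omega>. Z 0 \<omega> $ h) -` A \<inter> space M | h A. A \<in> sets borel} \<union>
      {(\<lambda>\<omega>. I k \<omega> $ h) -` A \<inter> space M | k h A. 1 \<le> k \<and> k \<le> n \<and> A \<in> sets borel})"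

locale reinforced_system = prob_space M
  for M :: "'a measure" +
  fixes \<alpha> \<beta> q :: real
    and f :: "real \<Rightarrow> real"
    and r :: "nat \<Rightarrow> real"
    and Z I :: "nat \<Rightarrow> 'a \<Rightarrow> real ^ 'n::finite"
  assumes card_ge_2: "CARD('n) \<ge> 2"
    and alpha: "0 \<le> \<alpha>" "\<alpha> < 1"
    and beta: "0 \<le> \<beta>" "\<beta> < 1"
    and alpha_beta: "0 < \<alpha> + \<beta>" "\<alpha> + \<beta> < 1"
    and q: "0 < q" "q \<le> 1"
    and f_range: "\<And>x. x \<in> {0..1} \<Longrightarrow> f x \<in> {0..1}"
    and f_strict_mono: "strict_mono_on {0..1} f"
    and f_C1: "\<exists>f'. continuous_on {0..1} f' \<and>
                 (\<forall>x\<in>{0..1}. (f has_real_derivative f' x) (at x within {0..1}))"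
    and r_range: "\<And>n. r n \<in> {0..1}"
    and r_lim: "(\<lambda>n. real n * r n) \<longlonglongrightarrow> 1"
    and Z0_measurable: "Z 0 \<in> borel_measurable M"
    and Z0_range: "\<And>\<omega> h. \<omega> \<in> space M \<Longrightarrow> Z 0 \<omega> $ h \<in> {0..1}"
    and I_measurable: "\<And>n. I (Suc n) \<in> borel_measurable M"
    and I_range: "\<And>n \<omega> h. \<omega> \<in> space M \<Longrightarrow> I (Suc n) \<omega> $ h \<in> {0, 1}"
    and Z_Suc: "\<And>n \<omega> h. \<omega> \<in> space M \<Longrightarrow>
                  Z (Suc n) \<omega> $ h = (1 - r n) * Z n \<omega> $ h + r n * I (Suc n) \<omega> $ h"
    and I_cond_indep: "\<And>n. cond_indep_vars M (history M Z I n) (\<lambda>_. borel)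
                         (\<lambda>h \<omega>. I (Suc n) \<omega> $ h) UNIV"
    and I_cond_prob: "\<And>n h. AE \<omega> in M.
          real_cond_exp M (history M Z I n) (indicator {\<omega> \<in> space M. I (Suc n) \<omega> $ h = 1}) \<omega> =
          \<alpha> * mean (Z n \<omega>) + \<beta> * q + (1 - \<alpha> - \<beta>) * f (Z n \<omega> $ h)"

definition drift ::
    "real \<Rightarrow> real \<Rightarrow> real \<Rightarrow> (real \<Rightarrow> real) \<Rightarrow> real ^ 'n::finite \<Rightarrow> real ^ 'n" where
  "drift \<alpha> \<beta> q f z = (\<chi> h. \<alpha> * mean z + \<beta> * q + (1 - \<alpha> - \<beta>) * f (z $ h) - z $ h)"

definition zero_points :: "(real ^ 'n::finite \<Rightarrow> real ^ 'n) \<Rightarrow> (real ^ 'n) set" where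
  "zero_points F = {z \<in> cbox 0 1. F z = 0}"

definition eigenvalue :: "real ^ 'n ^ 'n::finite \<Rightarrow> real \<Rightarrow> bool" where
  "eigenvalue A c \<longleftrightarrow> (\<exists>v. v \<noteq> 0 \<and> A *v v = c *\<^sub>R v)"

text \<open>The vector field is only given on the unit cube, so its Jacobian matrix is taken within the
  cube. It is symmetric for \<^const>\<open>drift\<close>, so real eigenvalues suffice.\<close>

definition stable_zero_points :: "(real ^ 'n::finite \<Rightarrow> real ^ 'n) \<Rightarrow> (real ^ 'n) set" where
  "stable_zero_points F =
    {z \<in> zero_points F. \<forall>c. eigenvalue (jacobian F (at z within cbox 0 1)) c \<longrightarrow> c \<le> 0}"

definition f_theta :: "real \<Rightarrow> real \<Rightarrow> real" where
  "f_theta \<theta> x = (1 - \<theta>) + (2 * \<theta> - 1) * (3 * x ^ 2 - 2 * x ^ 3)"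

text \<open>\<^const>\<open>f_theta\<close> meets the requirements on \<open>f\<close> in \<^locale>\<open>reinforced_system\<close>, so
  instantiating the locale with it adds no hypothesis.\<close>

lemma f_theta_has_derivative:
  "(f_theta \<theta> has_real_derivative (2 * \<theta> - 1) * (6 * x * (1 - x))) (at x within S)"
  unfolding f_theta_def
  by (auto intro!: derivative_eq_intros simp: field_simps power2_eq_square)

lemma f_theta_C1:
  "\<exists>f'. continuous_on {0..1} f' \<and>
     (\<forall>x\<in>{0..1}. (f_theta \<theta> has_real_derivative f' x) (at x within {0..1}))"
  by (rule exI[where x = "\<lambda>x. (2 * \<theta> - 1) * (6 * x * (1 - x))"])
     (auto intro!: continuous_intros f_theta_has_derivative)

lemma f_theta_strict_mono:
  assumes "1/2 < \<theta>"
  shows "strict_mono_on {0..1} (f_theta \<theta>)"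
proof (rule strict_mono_onI)
  fix x y :: real
  assume xy: "x \<in> {0..1}" "y \<in> {0..1}" "x < y"
  show "f_theta \<theta> x < f_theta \<theta> y"
  proof (rule DERIV_pos_imp_increasing_open[OF xy(3)])
    fix t assume "x < t" "t < y"
    with xy assms show "\<exists>d. (f_theta \<theta> has_real_derivative d) (at t) \<and> d > 0"
      by (intro exI[of _ "(2 * \<theta> - 1) * (6 * t * (1 - t))"] conjI f_theta_has_derivative) auto
  next
    show "continuous_on {x..y} (f_theta \<theta>)"
      unfolding f_theta_def by (intro continuous_intros)
  qed
qed

lemma f_theta_range:
  assumes "1/2 < \<theta>" "\<theta> < 1" "x \<in> {0..1}"
  shows "f_theta \<theta> x \<in> {0..1}"
proof -
  have mono: "mono_on {0..1} (f_theta \<theta>)"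
    using f_theta_strict_mono[OF assms(1)] by (rule strict_mono_on_imp_mono_on)
  have "f_theta \<theta> 0 \<le> f_theta \<theta> x" "f_theta \<theta> x \<le> f_theta \<theta> 1"
    using assms(3) by (auto intro!: mono_onD[OF mono])
  then show ?thesis
    using assms by (simp add: f_theta_def)
qed

end

(* Synchronisation and convergence. Since Z(n+1) = Z(n) + r(n) (F(Z(n)) + noise) and the noise series
   converges almost surely, every path follows a recursion with vanishing perturbation. Under the
   condition on theta, x - (1 - alpha - beta) f(x) is strictly increasing, so differences of components
   tend to 0; each component then follows the scalar drift phi(x) = alpha x + beta q
   + (1 - alpha - beta) f(x) - x, a cubic, and converges to one of its finitely many zeros.

   Instability. At a zero u with phi'(u) > 0 the transversal directions may contract arbitrarily
   slowly, so no linearisation argument is used. Instead, the success probabilities are increasing in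
   the state: two copies of the chain can be coupled monotonically, and while both are near u their gap
   grows on average by the factor 1 + kappa r(n). Starting from the gap r(n) that a single all-0 or all-1
   draw creates, a Laplace transform estimate shows that with probability bounded below one of the
   copies leaves the neighbourhood of u. Hence from every late state the chain leaves it with
   probability bounded below, and it almost surely cannot stay there forever. *)

theory Submission
  imports Defs
begin

text \<open>Write \<gamma> for \<open>1 - \<alpha> - \<beta>\<close>. The hypothesis on \<theta>
  says that \<gamma> times the slope of f is at most 1, with its maximum at 1/2, and equality is
  allowed. In that case differences of components have no linear contraction at 1/2, so
  synchronisation rests on a cubic remainder. Stability is nevertheless a scalar matter: at a
  diagonal zero the Jacobian is a multiple of the identity plus \<alpha> times averaging, and the
  slope of phi is its largest eigenvalue. The escape estimate has to work for initial gaps of order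
  1/n. The Laplace parameter therefore starts at order n, so that its product with the gap is
  bounded below for all large n. Since r is not summable, the parameter can decrease by any
  prescribed factor while the exponential bound is kept; it ends at a small constant, whereas the
  gap never exceeds N. Since \<theta> < 1, success probabilities stay away from 0 and 1, which gives
  the all-0 and all-1 draws a probability bounded below.\<close>

section \<open>Scalar recursions with summable noise\<close>

text \<open>One step is too short to jump over the strip of width \<delta> above \<open>c\<close>,
  and inside that strip the drift does not point down. Hence \<open>c\<close> is a barrier that late
  paths cannot cross downwards.\<close>

lemma stays_above:
  fixes y a b :: "nat \<Rightarrow> real"
  assumes step: "\<And>n. y (Suc n) = y n + a n * b n"
    and a: "\<And>n. 0 \<le> a n" "\<And>n. m \<le> n \<Longrightarrow> a n * B \<le> \<delta>"
    and b: "\<And>n. \<bar>b n\<bar> \<le> B"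
    and push: "\<And>n. m \<le> n \<Longrightarrow> \<bar>y n - c\<bar> < \<delta> \<Longrightarrow> 0 \<le> b n"
    and start: "m \<le> k" "c \<le> y k" and "k \<le> n"
  shows "c \<le> y n"
  using \<open>k \<le> n\<close>
proof (induction n rule: dec_induct)
  case (step n)
  show ?case
  proof (cases "y n < c + \<delta>")
    case True
    then have "0 \<le> b n" using step start by (intro push) auto
    then show ?thesis using step.IH a(1)[of n] by (simp add: assms(1) add_increasing2)
  next
    case False
    have "a n * - B \<le> a n * b n" using b[of n] a(1)[of n] by (intro mult_left_mono) auto
    moreover have "a n * B \<le> \<delta>" using a(2)[of n] step start by auto
    ultimately show ?thesis using False by (simp add: assms(1))
  qed
qed (fact start(2))

text \<open>Every level outside \<open>S\<close> is eventually a gate that can be passed in one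
  direction only, which excludes oscillation. A limit outside \<open>S\<close> is excluded because
  increments of constant sign and size at least \<open>\<eta> * a n\<close> would have to be
  summable.\<close>

lemma drift_recursion_limit:
  fixes y a b :: "nat \<Rightarrow> real"
  assumes step: "\<And>n. y (Suc n) = y n + a n * b n"
    and a: "\<And>n. 0 \<le> a n" "a \<longlonglongrightarrow> 0" "\<not> summable a"
    and b: "\<And>n. \<bar>b n\<bar> \<le> B"
    and y: "Bseq y"
    and push: "\<And>c. c \<notin> S \<Longrightarrow> \<exists>\<delta>>0. \<exists>\<eta>>0. \<exists>s\<in>{1, -1}.
                 \<forall>\<^sub>F n in sequentially. \<bar>y n - c\<bar> < \<delta> \<longrightarrow> \<eta> \<le> s * b n"
    and S: "finite S"
  shows "\<exists>l\<in>S. y \<longlonglongrightarrow> l"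
proof -
  have aB: "\<forall>\<^sub>F n in sequentially. a n * B \<le> \<delta>" if "\<delta> > 0" for \<delta>
    using order_tendstoD(2)[OF tendsto_mult_left_zero[OF a(2)] that, of B]
    by (auto elim: eventually_mono)
  have "convergent y"
  proof (rule ccontr)
    assume nc: "\<not> convergent y"
    have "bounded (range y)" using y by (simp add: Bseq_eq_bounded)
    then obtain l1 and f :: "nat \<Rightarrow> nat" where f: "strict_mono f" "(y \<circ> f) \<longlonglongrightarrow> l1"
      using bounded_imp_convergent_subsequence by blast
    have "\<not> y \<longlonglongrightarrow> l1" using nc by (auto simp: convergent_def)
    then obtain e where e: "e > 0" "\<And>N. \<exists>n\<ge>N. e \<le> \<bar>y n - l1\<bar>"
      unfolding LIMSEQ_def by (auto simp: dist_real_def not_less)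
    have near: "\<exists>n\<ge>N. \<bar>y n - l1\<bar> < d" if d: "d > 0" for d N
    proof -
      obtain n0 where "\<And>n. n \<ge> n0 \<Longrightarrow> \<bar>y (f n) - l1\<bar> < d"
        using LIMSEQ_D[OF f(2) d] by (auto simp: o_def)
      moreover have "f (max n0 N) \<ge> N" using seq_suble[OF f(1), of "max n0 N"] by linarith
      ultimately show ?thesis by (metis max.cobounded1)
    qed
    text \<open>If \<open>y\<close> oscillated, it would cross some level \<open>c\<close> outside \<open>S\<close> infinitely often in both
      directions, whereas near \<open>c\<close> the drift points in one direction only.\<close>
    have crossing: False if "u \<in> {1, -1}" and far: "\<And>N. \<exists>n\<ge>N. e \<le> u * (y n - l1)" for u :: real
    proof -
      \<comment> \<open>The level has to lie strictly between the limit point and the far excursions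
        and outside \<open>S\<close>; an open interval contains such points because \<open>S\<close>
        is finite.\<close>
      have "\<exists>c'\<in>{0<..<e}. l1 + u * c' \<notin> S"
      proof (rule ccontr)
        assume "\<not> ?thesis"
        then have "(\<lambda>c. l1 + u * c) ` {0<..<e} \<subseteq> S" by auto
        then have "finite ((\<lambda>c. l1 + u * c) ` {0<..<e})" using S finite_subset by blast
        moreover have "inj_on (\<lambda>c. l1 + u * c) {0<..<e}" using that(1) by (auto intro!: inj_onI)
        ultimately show False using finite_imageD infinite_Ioo[OF e(1)] by blast
      qed
      then obtain c' where c': "0 < c'" "c' < e" "l1 + u * c' \<notin> S" by auto
      from push[OF c'(3)] obtain \<delta> \<eta> s where
        ds: "\<delta> > 0" "\<eta> > 0" "s \<in> {1, -1}"
        and ev: "\<forall>\<^sub>F n in sequentially. \<bar>y n - (l1 + u * c')\<bar> < \<delta> \<longrightarrow> \<eta> \<le> s * b n" by blast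
      from eventually_conj[OF ev aB[OF ds(1)]] obtain m where
        m: "\<And>n. n \<ge> m \<Longrightarrow> \<bar>y n - (l1 + u * c')\<bar> < \<delta> \<Longrightarrow> \<eta> \<le> s * b n"
           "\<And>n. n \<ge> m \<Longrightarrow> a n * B \<le> \<delta>"
        unfolding eventually_sequentially by blast
      \<comment> \<open>Multiplying by \<open>s\<close> turns both drift directions into an upward
        one.\<close>
      have barrier: "s * (l1 + u * c') \<le> s * y n"
        if "m \<le> k" "s * (l1 + u * c') \<le> s * y k" "k \<le> n" for k n
      proof (rule stays_above[where y = "\<lambda>n. s * y n" and a = a and b = "\<lambda>n. s * b n"
            and \<delta> = \<delta> and B = B and m = m and k = k])
        show "s * y (Suc n) = s * y n + a n * (s * b n)" for n
          by (simp add: step algebra_simps)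
        show "\<bar>s * b n\<bar> \<le> B" for n using b[of n] ds(3) by auto
        fix n assume n: "m \<le> n" "\<bar>s * y n - s * (l1 + u * c')\<bar> < \<delta>"
        have "\<bar>s * y n - s * (l1 + u * c')\<bar> = \<bar>y n - (l1 + u * c')\<bar>"
          using ds(3) by (auto simp: abs_minus_commute)
        then show "0 \<le> s * b n" using m(1)[OF n(1)] n(2) ds(2) by linarith
      qed (use a m that in auto)
      have "s * u \<in> {1, -1}" using ds(3) that(1) by auto
      obtain k1 where k1: "k1 \<ge> m" "e \<le> u * (y k1 - l1)" using far by blast
      obtain k2 where k2: "k2 \<ge> k1" "\<bar>y k2 - l1\<bar> < c'" using near c'(1) by blast
      obtain k3 where k3: "k3 \<ge> k2" "e \<le> u * (y k3 - l1)" using far by blast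
      show False
      \<comment> \<open>A drift pointing away from \<open>l1\<close> forbids the return between
        \<open>k1\<close> and \<open>k2\<close>; a drift pointing towards \<open>l1\<close> forbids
        the excursion between \<open>k2\<close> and \<open>k3\<close>.\<close>
      proof (cases "s = u")
        case True
        have "s * (l1 + u * c') \<le> s * y k2"
          using k1 k2(1) c' True that(1) by (intro barrier[of k1 k2]) auto
        then show False using k2 True that(1) by auto
      next
        case False
        have "s * (l1 + u * c') \<le> s * y k3"
          using k1(1) k2 k3(1) c' False that(1) ds(3) by (intro barrier[of k2 k3]) auto
        then show False using k3 c' False that(1) ds(3) by auto
      qed
    qed
    show False
    proof (cases "\<forall>N. \<exists>n\<ge>N. e \<le> y n - l1")
      case True
      then show False using crossing[of 1] by auto
    next
      case False
      then obtain N0 where N0: "\<And>n. n \<ge> N0 \<Longrightarrow> y n - l1 < e" by (meson not_le)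
      have "\<exists>n\<ge>N. e \<le> -1 * (y n - l1)" for N
        using e(2)[of "max N N0"] N0 by (force simp: abs_if split: if_splits)
      then show False using crossing[of "-1"] by auto
    qed
  qed
  then obtain l where l: "y \<longlonglongrightarrow> l" by (auto simp: convergent_def)
  have "l \<in> S"
  proof (rule ccontr)
    assume "l \<notin> S"
    from push[OF this] obtain \<delta> \<eta> s where
      ds: "\<delta> > 0" "\<eta> > 0" "s \<in> {1, -1}"
      and ev: "\<forall>\<^sub>F n in sequentially. \<bar>y n - l\<bar> < \<delta> \<longrightarrow> \<eta> \<le> s * b n" by blast
    have "\<forall>\<^sub>F n in sequentially. \<bar>y n - l\<bar> < \<delta>"
      using tendstoD[OF l ds(1)] by (simp add: dist_real_def)
    with ev have "\<forall>\<^sub>F n in sequentially. norm (a n * \<eta>) \<le> s * (y (Suc n) - y n)"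
    proof eventually_elim
      case (elim n)
      then have "a n * \<eta> \<le> a n * (s * b n)" using a(1)[of n] by (intro mult_left_mono) auto
      then show ?case using ds(2) a(1)[of n] by (simp add: step algebra_simps)
    qed
    moreover have "summable (\<lambda>n. s * (y (Suc n) - y n))"
      using telescope_summable[OF l] by (intro summable_mult) auto
    ultimately have "summable (\<lambda>n. a n * \<eta>)" by (rule summable_comparison_test_ev)
    then show False using a(3) ds(2) summable_mult_D[of \<eta> a] by (simp add: mult.commute)
  qed
  with l show ?thesis by blast
qed

text \<open>Adding the tail of the convergent noise series to \<open>x\<close> removes the noise from the recursion.\<close>

lemma noisy_recursion_limit:
  fixes x a b e :: "nat \<Rightarrow> real"
  assumes step: "\<And>n. x (Suc n) = x n + a n * (b n + e n)"
    and a: "\<And>n. 0 \<le> a n" "a \<longlonglongrightarrow> 0" "\<not> summable a"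
    and e: "summable (\<lambda>n. a n * e n)"
    and b: "\<And>n. \<bar>b n\<bar> \<le> B"
    and x: "Bseq x"
    and push: "\<And>c. c \<notin> S \<Longrightarrow> \<exists>\<delta>>0. \<exists>\<eta>>0. \<exists>s\<in>{1, -1}.
                 \<forall>\<^sub>F n in sequentially. \<bar>x n - c\<bar> < \<delta> \<longrightarrow> \<eta> \<le> s * b n"
    and S: "finite S"
  shows "\<exists>l\<in>S. x \<longlonglongrightarrow> l"
proof -
  define t where "t n = (\<Sum>k. a (k + n) * e (k + n))" for n
  define y where "y n = x n + t n" for n
  have t0: "t \<longlonglongrightarrow> 0"
    unfolding t_def using suminf_exist_split2[OF e] by simp
  have tS: "t n = a n * e n + t (Suc n)" for n
    unfolding t_def using suminf_split_head[of "\<lambda>k. a (k + n) * e (k + n)"] e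
    by (simp add: summable_iff_shift[of "\<lambda>k. a k * e k"])
  have "\<exists>l\<in>S. y \<longlonglongrightarrow> l"
  proof (rule drift_recursion_limit[OF _ a b _ _ S])
    show "y (Suc n) = y n + a n * b n" for n
      using tS[of n] by (simp add: y_def step algebra_simps)
    have "Bseq t" using t0 convergentI convergent_imp_Bseq by blast
    then have "bounded (range x)" "bounded (range t)" using x by (simp_all add: Bseq_eq_bounded)
    from bounded_plus_comp[OF this] show "Bseq y" by (simp add: Bseq_eq_bounded y_def)
    fix c assume "c \<notin> S"
    from push[OF this] obtain \<delta> \<eta> s where
      ds: "\<delta> > 0" "\<eta> > 0" "s \<in> {1, -1}"
      and ev: "\<forall>\<^sub>F n in sequentially. \<bar>x n - c\<bar> < \<delta> \<longrightarrow> \<eta> \<le> s * b n" by blast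
    have "\<forall>\<^sub>F n in sequentially. \<bar>t n\<bar> < \<delta> / 2"
      using tendstoD[OF t0, of "\<delta> / 2"] ds(1) by (simp add: dist_real_def)
    with ev have "\<forall>\<^sub>F n in sequentially. \<bar>y n - c\<bar> < \<delta> / 2 \<longrightarrow> \<eta> \<le> s * b n"
      by eventually_elim (unfold y_def, argo)
    then show "\<exists>\<delta>>0. \<exists>\<eta>>0. \<exists>s\<in>{1, -1}.
        \<forall>\<^sub>F n in sequentially. \<bar>y n - c\<bar> < \<delta> \<longrightarrow> \<eta> \<le> s * b n"
      \<comment> \<open>Half of \<delta> is reserved for the tail \<open>t\<close>, since the level
        is compared with \<open>y\<close> while the drift condition speaks of
        \<open>x\<close>.\<close>
      using ds by (intro exI[of _ "\<delta> / 2"] exI[of _ \<eta>] bexI[of _ s] conjI) auto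
  qed
  then obtain l where "l \<in> S" "y \<longlonglongrightarrow> l" by blast
  moreover have "x \<longlonglongrightarrow> l" using tendsto_diff[OF \<open>y \<longlonglongrightarrow> l\<close> t0] by (simp add: y_def)
  ultimately show ?thesis by blast
qed

section \<open>Almost sure convergence of orthogonal series along cubic blocks\<close>

lemma cubic_block_bound:
  "(real (Suc j ^ 3) - real (j ^ 3)) / (real j ^ 3 + 1) \<le> 14 / real (Suc j)"
proof -
  have pow: "real j ^ 2 \<le> real j ^ 3" "real j \<le> real j ^ 3"
    using power_increasing[of 2 3 "real j"] power_increasing[of 1 3 "real j"] by (cases "j = 0"; simp)+
  \<comment> \<open>Bounding both lower powers of j by j^3 leaves the constant 14, the sum of the
    coefficients 3, 6, 4 and 1.\<close>
  have "(real (Suc j ^ 3) - real (j ^ 3)) * real (Suc j) = 3 * real j ^ 3 + 6 * real j ^ 2 + 4 * real j + 1"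
    by (simp add: algebra_simps power2_eq_square power3_eq_cube)
  moreover have "3 * u + 6 * v + 4 * w + 1 \<le> 14 * (u + 1)" if "v \<le> u" "w \<le> u" "0 \<le> w" for u v w :: real
    using that by argo
  from this[OF pow of_nat_0_le_iff]
  have "3 * real j ^ 3 + 6 * real j ^ 2 + 4 * real j + 1 \<le> 14 * (real j ^ 3 + 1)" .
  ultimately show ?thesis
    by (subst divide_le_eq, simp add: add_pos_nonneg add_nonneg_pos)
       (simp add: field_simps add_pos_nonneg add_nonneg_pos)
qed

lemma cubic_block_index: "\<exists>j::nat. j ^ 3 \<le> n \<and> n < Suc j ^ 3"
proof -
  define j where "j = (LEAST j. n < Suc j ^ 3)"
  have "n < Suc n ^ 3" by (simp add: power3_eq_cube)
  then have "n < Suc j ^ 3" unfolding j_def by (rule LeastI)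
  moreover have "j ^ 3 \<le> n"
  proof (cases j)
    case (Suc i)
    then have "\<not> n < Suc i ^ 3" using not_less_Least[of i "\<lambda>j. n < Suc j ^ 3"] by (simp add: j_def)
    then show ?thesis using Suc by simp
  qed simp
  ultimately show ?thesis by blast
qed

text \<open>The block sums give convergence of the partial sums at the cubes. A general index lies
  in the block of its integer cube root \<open>r n\<close>, where the partial sums move by at most
  the block length times the bound on a single term, which is of order 1 over
  \<open>r n\<close>.\<close>

lemma summable_cubic_blocks:
  fixes v :: "nat \<Rightarrow> real"
  assumes v: "\<And>n. \<bar>v n\<bar> \<le> C / real (Suc n)"
    and blocks: "summable (\<lambda>j. \<Sum>n = j ^ 3..<Suc j ^ 3. v n)"
  shows "summable v"
proof -
  define V where "V n = (\<Sum>k<n. v k)" for n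
  have C: "0 \<le> C" using v[of 0] by simp
  have V_cube: "V (j ^ 3) = (\<Sum>i<j. \<Sum>n = i ^ 3..<Suc i ^ 3. v n)" for j
  proof (induction j)
    case (Suc j)
    have "j ^ 3 \<le> Suc j ^ 3" by (rule power_mono) auto
    from sum.atLeastLessThan_concat[OF le0 this, of v] show ?case
      using Suc by (simp add: V_def lessThan_atLeast0)
  qed (simp add: V_def)
  obtain r where r: "\<And>n. r n ^ 3 \<le> n" "\<And>n. n < Suc (r n) ^ 3"
    using cubic_block_index by metis
  have r_top: "filterlim r at_top sequentially"
    unfolding filterlim_at_top eventually_sequentially
  proof (intro allI exI impI)
    fix K n :: nat assume n: "Suc K ^ 3 \<le> n"
    show "K \<le> r n"
    proof (rule ccontr)
      assume "\<not> K \<le> r n"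
      then have "Suc (r n) ^ 3 \<le> Suc K ^ 3" by (intro power_mono) auto
      with n r(2)[of n] show False by linarith
    qed
  qed
  have rest: "\<bar>V n - V (r n ^ 3)\<bar> \<le> 14 * C / real (Suc (r n))" for n
  proof -
    have "V n - V (r n ^ 3) = (\<Sum>k = r n ^ 3..<n. v k)"
      using sum.atLeastLessThan_concat[OF le0 r(1), of v n] by (simp add: V_def lessThan_atLeast0)
    also have "\<bar>\<dots>\<bar> \<le> (\<Sum>k = r n ^ 3..<n. \<bar>v k\<bar>)" by (rule sum_abs)
    also have "\<dots> \<le> (\<Sum>k = r n ^ 3..<n. C / (real (r n) ^ 3 + 1))"
    proof (rule sum_mono)
      fix k assume "k \<in> {r n ^ 3..<n}"
      then have "real (r n ^ 3) \<le> real k" by (intro of_nat_mono) auto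
      then have "C / real (Suc k) \<le> C / (real (r n) ^ 3 + 1)"
        using C by (intro divide_left_mono mult_pos_pos add_nonneg_pos) auto
      then show "\<bar>v k\<bar> \<le> C / (real (r n) ^ 3 + 1)" using v[of k] by linarith
    qed
    also have "\<dots> = real (n - r n ^ 3) * (C / (real (r n) ^ 3 + 1))" by simp
    also have "\<dots> \<le> (real (Suc (r n) ^ 3) - real (r n ^ 3)) * (C / (real (r n) ^ 3 + 1))"
    proof (rule mult_right_mono)
      have "real n \<le> real (Suc (r n) ^ 3)" using r(2)[of n] by (intro of_nat_mono) auto
      then show "real (n - r n ^ 3) \<le> real (Suc (r n) ^ 3) - real (r n ^ 3)"
        using r(1)[of n] by (simp add: of_nat_diff)
    qed (use C in auto)
    also have "\<dots> = C * ((real (Suc (r n) ^ 3) - real (r n ^ 3)) / (real (r n) ^ 3 + 1))" by simp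
    also have "\<dots> \<le> C * (14 / real (Suc (r n)))"
      by (rule mult_left_mono[OF cubic_block_bound C])
    finally show ?thesis by (simp add: mult.commute)
  qed
  have "(\<lambda>j. 14 * C / real (Suc j)) \<longlonglongrightarrow> 0"
    using LIMSEQ_Suc[OF lim_const_over_n[of "14 * C"]] by simp
  from filterlim_compose[OF this r_top] have "(\<lambda>n. 14 * C / real (Suc (r n))) \<longlonglongrightarrow> 0" .
  then have "(\<lambda>n. V n - V (r n ^ 3)) \<longlonglongrightarrow> 0"
    by (rule Lim_null_comparison[rotated]) (use rest in auto)
  moreover have "(\<lambda>j. V (j ^ 3)) \<longlonglongrightarrow> (\<Sum>j. \<Sum>n = j ^ 3..<Suc j ^ 3. v n)"
    unfolding V_cube by (rule summable_LIMSEQ[OF blocks])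
  then have "(\<lambda>n. V (r n ^ 3)) \<longlonglongrightarrow> (\<Sum>j. \<Sum>n = j ^ 3..<Suc j ^ 3. v n)"
    by (rule filterlim_compose[OF _ r_top])
  ultimately have "(\<lambda>n. V n - V (r n ^ 3) + V (r n ^ 3)) \<longlonglongrightarrow> 0 + (\<Sum>j. \<Sum>n = j ^ 3..<Suc j ^ 3. v n)"
    by (rule tendsto_add)
  then show ?thesis unfolding summable_def sums_def V_def by auto
qed

text \<open>Monotone convergence: the sum of the absolute values has finite expectation, hence is
  finite almost surely.\<close>

lemma AE_summable_if_summable_integrals:
  fixes S :: "nat \<Rightarrow> 'a \<Rightarrow> real"
  assumes S: "\<And>j. integrable M (S j)" and b: "\<And>j. (\<integral>\<omega>. \<bar>S j \<omega>\<bar> \<partial>M) \<le> b j" and "summable b"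
  shows "AE \<omega> in M. summable (\<lambda>j. S j \<omega>)"
proof -
  have [measurable]: "S j \<in> borel_measurable M" for j using S by (rule borel_measurable_integrable)
  have b0: "0 \<le> b j" for j using b[of j] by (rule order_trans[rotated]) simp
  have "(\<integral>\<^sup>+\<omega>. (\<Sum>j. ennreal \<bar>S j \<omega>\<bar>) \<partial>M) = (\<Sum>j. \<integral>\<^sup>+\<omega>. ennreal \<bar>S j \<omega>\<bar> \<partial>M)"
    by (rule nn_integral_suminf) measurable
  also have "\<dots> = (\<Sum>j. ennreal (\<integral>\<omega>. \<bar>S j \<omega>\<bar> \<partial>M))"
    using S by (intro suminf_cong nn_integral_eq_integral) auto
  also have "\<dots> \<le> (\<Sum>j. ennreal (b j))"
    using b by (intro suminf_le ennreal_leI summableI) auto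
  also have "\<dots> < \<infinity>" using \<open>summable b\<close> b0 by (simp add: suminf_ennreal2)
  finally have "(\<integral>\<^sup>+\<omega>. (\<Sum>j. ennreal \<bar>S j \<omega>\<bar>) \<partial>M) \<noteq> \<infinity>" by simp
  then have "AE \<omega> in M. (\<Sum>j. ennreal \<bar>S j \<omega>\<bar>) \<noteq> \<infinity>"
    by (intro nn_integral_PInf_AE) measurable
  then show ?thesis
  proof eventually_elim
    case (elim \<omega>)
    then have "summable (\<lambda>j. \<bar>S j \<omega>\<bar>)" by (intro summable_suminf_not_top) auto
    then show ?case by (rule summable_rabs_cancel)
  qed
qed

text \<open>The variance of the block \<open>{j\<^sup>3..<(j+1)\<^sup>3}\<close> is of order \<open>j\<^sup>-\<^sup>4\<close>, hence the sums over
  the blocks are absolutely summable, while within a block the partial sums vary by only \<open>O(1/j)\<close>.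
  No maximal inequality is needed.\<close>

lemma (in prob_space) AE_summable_orthogonal:
  fixes D :: "nat \<Rightarrow> 'a \<Rightarrow> real"
  assumes D[measurable]: "\<And>n. D n \<in> borel_measurable M"
    and D_le: "\<And>n \<omega>. \<omega> \<in> space M \<Longrightarrow> \<bar>D n \<omega>\<bar> \<le> 1"
    and orth: "\<And>j k. j < k \<Longrightarrow> expectation (\<lambda>\<omega>. D j \<omega> * D k \<omega>) = 0"
    and a: "\<And>n. 0 \<le> a n" "\<And>n. a n \<le> C / real (Suc n)"
  shows "AE \<omega> in M. summable (\<lambda>n. a n * D n \<omega>)"
proof -
  define S where "S j \<omega> = (\<Sum>n = j ^ 3..<Suc j ^ 3. a n * D n \<omega>)" for j \<omega>
  have C: "0 \<le> C" using a[of 0] by simp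
  have bdd: "integrable M g" if "g \<in> borel_measurable M" "\<And>\<omega>. \<omega> \<in> space M \<Longrightarrow> \<bar>g \<omega>\<bar> \<le> B"
    for g :: "'a \<Rightarrow> real" and B
    using that by (intro integrable_const_bound[where B = B]) auto
  have DD: "\<bar>D m \<omega> * D n \<omega>\<bar> \<le> 1" if "\<omega> \<in> space M" for m n \<omega>
    using mult_mono[OF D_le[OF that] D_le[OF that]] by (simp add: abs_mult)
  have int_D: "integrable M (D n)" for n by (rule bdd[OF D D_le])
  have int_DD: "integrable M (\<lambda>\<omega>. D m \<omega> * D n \<omega>)" for m n
    by (rule bdd[OF _ DD]) measurable
  have int_S: "integrable M (S j)" for j
    unfolding S_def using int_D by (intro Bochner_Integration.integrable_sum integrable_mult_right)
  have S_sq: "(S j \<omega>)\<^sup>2 = (\<Sum>m = j ^ 3..<Suc j ^ 3. \<Sum>n = j ^ 3..<Suc j ^ 3. a m * a n * (D m \<omega> * D n \<omega>))"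
    for j \<omega> by (simp add: S_def power2_eq_square sum_product mult_ac)
  have int_S_sq: "integrable M (\<lambda>\<omega>. (S j \<omega>)\<^sup>2)" for j
    unfolding S_sq using int_DD by (intro Bochner_Integration.integrable_sum integrable_mult_right)
  have E_DD: "expectation (\<lambda>\<omega>. D m \<omega> * D n \<omega>) \<le> (if m = n then 1 else 0)" for m n
  proof (cases m n rule: linorder_cases)
    case equal
    have "expectation (\<lambda>\<omega>. D n \<omega> * D n \<omega>) \<le> expectation (\<lambda>_. 1)"
      using DD[of _ n n] by (intro integral_mono int_DD) (auto simp: abs_le_iff)
    then show ?thesis using equal by (simp add: prob_space)
  next
    case greater
    then show ?thesis using orth[of n m] by (simp add: mult.commute)
  qed (use orth in auto)
  have E_S_sq: "expectation (\<lambda>\<omega>. (S j \<omega>)\<^sup>2) \<le> 14 * C\<^sup>2 / (real (Suc j) * (real j ^ 3 + 1))" for j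
  proof -
    have "expectation (\<lambda>\<omega>. (S j \<omega>)\<^sup>2) = (\<Sum>m = j ^ 3..<Suc j ^ 3. \<Sum>n = j ^ 3..<Suc j ^ 3.
        a m * a n * expectation (\<lambda>\<omega>. D m \<omega> * D n \<omega>))"
      unfolding S_sq using int_DD
      by (simp add: Bochner_Integration.integral_sum Bochner_Integration.integrable_sum)
    also have "\<dots> \<le> (\<Sum>m = j ^ 3..<Suc j ^ 3. \<Sum>n = j ^ 3..<Suc j ^ 3. a m * a n * (if m = n then 1 else 0))"
      using a(1) E_DD by (intro sum_mono mult_left_mono) auto
    also have "\<dots> = (\<Sum>m = j ^ 3..<Suc j ^ 3. (a m)\<^sup>2)"
      by (rule sum.cong[OF refl]) (simp add: if_distrib power2_eq_square cong: if_cong)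
    also have "\<dots> \<le> (\<Sum>m = j ^ 3..<Suc j ^ 3. (C / (real j ^ 3 + 1))\<^sup>2)"
    proof (rule sum_mono, rule power_mono[OF _ a(1)])
      fix k assume "k \<in> {j ^ 3..<Suc j ^ 3}"
      then have "real (j ^ 3) \<le> real k" by (intro of_nat_mono) auto
      then have "C / real (Suc k) \<le> C / (real j ^ 3 + 1)"
        using C by (intro divide_left_mono mult_pos_pos add_nonneg_pos) auto
      then show "a k \<le> C / (real j ^ 3 + 1)" using a(2)[of k] by linarith
    qed
    also have "\<dots> = (real (Suc j ^ 3) - real (j ^ 3)) / (real j ^ 3 + 1) * (C\<^sup>2 / (real j ^ 3 + 1))"
    proof -
      have "j ^ 3 \<le> Suc j ^ 3" by (rule power_mono) auto
      then show ?thesis by (simp add: of_nat_diff power2_eq_square del: of_nat_power power_Suc)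
    qed
    also have "\<dots> \<le> 14 / real (Suc j) * (C\<^sup>2 / (real j ^ 3 + 1))"
      by (rule mult_right_mono[OF cubic_block_bound]) simp
    finally show ?thesis by simp
  qed
  have E_S: "expectation (\<lambda>\<omega>. \<bar>S j \<omega>\<bar>) \<le> (56 * C\<^sup>2 + 1) / (real (Suc j))\<^sup>2" for j
  proof -
    let ?t = "real (Suc j)"
    \<comment> \<open>Three times this product is 4 (j^3 + 1) - (j + 1)^3.\<close>
    have "(real j - 1)\<^sup>2 * (real j + 1) \<ge> 0" by simp
    then have cube: "?t ^ 3 \<le> 4 * (real j ^ 3 + 1)"
      by (simp add: power2_eq_square power3_eq_cube algebra_simps)
    \<comment> \<open>The weights balance the two terms: the second moment is of order j^-4, so
      after multiplication by \<open>?t\<^sup>2\<close> both terms are of order j^-2.\<close>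
    have "\<bar>S j \<omega>\<bar> \<le> ?t\<^sup>2 * (S j \<omega>)\<^sup>2 + 1 / ?t\<^sup>2" for \<omega>
    proof -
      have "0 \<le> (?t * \<bar>S j \<omega>\<bar> - 1 / ?t)\<^sup>2" by simp
      also have "\<dots> = ?t\<^sup>2 * (S j \<omega>)\<^sup>2 + 1 / ?t\<^sup>2 - 2 * \<bar>S j \<omega>\<bar>"
        by (simp add: power2_diff power_mult_distrib power_divide del: of_nat_Suc)
      finally show ?thesis by linarith
    qed
    then have "expectation (\<lambda>\<omega>. \<bar>S j \<omega>\<bar>) \<le> expectation (\<lambda>\<omega>. ?t\<^sup>2 * (S j \<omega>)\<^sup>2 + 1 / ?t\<^sup>2)"
      using int_S int_S_sq by (intro integral_mono) auto
    also have "\<dots> = ?t\<^sup>2 * expectation (\<lambda>\<omega>. (S j \<omega>)\<^sup>2) + 1 / ?t\<^sup>2"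
      using int_S_sq by (simp add: prob_space)
    also have "?t\<^sup>2 * expectation (\<lambda>\<omega>. (S j \<omega>)\<^sup>2) \<le> ?t\<^sup>2 * (14 * C\<^sup>2 / (?t * (real j ^ 3 + 1)))"
      by (rule mult_left_mono[OF E_S_sq]) simp
    also have "\<dots> \<le> ?t\<^sup>2 * (14 * C\<^sup>2 / (?t * (?t ^ 3 / 4)))"
      using cube by (intro mult_left_mono divide_left_mono mult_pos_pos add_nonneg_pos) auto
    also have "\<dots> = 56 * C\<^sup>2 / ?t\<^sup>2"
      by (simp add: power2_eq_square power3_eq_cube del: of_nat_Suc)
    finally show ?thesis by (simp add: add_divide_distrib)
  qed
  have "summable (\<lambda>j. (56 * C\<^sup>2 + 1) / (real (Suc j))\<^sup>2)"
    using inverse_power_summable[of 2, where 'a = real]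
    by (subst summable_Suc_iff[of "\<lambda>j. (56 * C\<^sup>2 + 1) / (real j)\<^sup>2"])
       (auto simp: divide_inverse intro!: summable_mult)
  from AE_summable_if_summable_integrals[OF int_S E_S this]
  have "AE \<omega> in M. summable (\<lambda>j. S j \<omega>)" .
  then show ?thesis
  proof (rule AE_mp, intro AE_I2 impI)
    fix \<omega> assume \<omega>: "\<omega> \<in> space M" and S: "summable (\<lambda>j. S j \<omega>)"
    have "\<bar>a n * D n \<omega>\<bar> \<le> C / real (Suc n)" for n
      using mult_mono[OF a(2) D_le[OF \<omega>], of n n] a(1)[of n] C by (simp add: abs_mult)
    from summable_cubic_blocks[OF this] S show "summable (\<lambda>n. a n * D n \<omega>)" by (simp add: S_def)
  qed
qed

section \<open>Monotone coupling and expansion\<close>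

lemma pmf_bool_eqI:
  assumes "pmf p True = pmf q True"
  shows "p = (q :: bool pmf)"
  using assms by (intro pmf_eqI) (metis pmf_False_conv_True)

text \<open>A finite sum over all outcomes instead of an integral: in this form the mean is visibly
  measurable in \<open>p\<close>, and it is what summing over the outcomes of one draw
  produces.\<close>

definition bernoulli_mean :: "('n::finite \<Rightarrow> real) \<Rightarrow> (('n \<Rightarrow> bool) \<Rightarrow> real) \<Rightarrow> real" where
  "bernoulli_mean p g = (\<Sum>i\<in>UNIV. (\<Prod>h\<in>UNIV. if i h then p h else 1 - p h) * g i)"

lemma bernoulli_mean_eq_expectation:
  assumes "\<And>h. 0 \<le> p h" "\<And>h. p h \<le> 1"
  shows "bernoulli_mean p g = measure_pmf.expectation (Pi_pmf UNIV False (\<lambda>h. bernoulli_pmf (p h))) g"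
proof -
  have "pmf (bernoulli_pmf (p h)) b = (if b then p h else 1 - p h)" for h b
    using assms by (cases b) auto
  then show ?thesis
    by (subst integral_measure_pmf_real[where A = UNIV])
       (auto simp: bernoulli_mean_def pmf_Pi mult.commute)
qed

lemma bernoulli_mean_const:
  assumes "\<And>h. 0 \<le> p h" "\<And>h. p h \<le> 1"
  shows "bernoulli_mean p (\<lambda>_. c) = c"
  using assms by (simp add: bernoulli_mean_eq_expectation)

lemma bernoulli_mean_mono:
  assumes "\<And>h. 0 \<le> p h" "\<And>h. p h \<le> 1" "\<And>i. g i \<le> g' i"
  shows "bernoulli_mean p g \<le> bernoulli_mean p g'"
  unfolding bernoulli_mean_def
  using assms by (intro sum_mono mult_left_mono prod_nonneg) auto

text \<open>Each outcome loses its weight times the nonnegative \<open>1 - g i\<close>; only the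
  losses of the two extreme outcomes, all failures and all successes, are kept.\<close>

lemma bernoulli_mean_extremes:
  fixes p :: "'n::finite \<Rightarrow> real"
  assumes p: "\<And>h. 0 \<le> p h" "\<And>h. p h \<le> 1" and g: "\<And>i. g i \<le> 1"
  shows "bernoulli_mean p g \<le>
    1 - (\<Prod>h\<in>UNIV. 1 - p h) * (1 - g (\<lambda>_. False)) - (\<Prod>h\<in>UNIV. p h) * (1 - g (\<lambda>_. True))"
proof -
  let ?w = "\<lambda>i. \<Prod>h\<in>UNIV. if i h then p h else 1 - p h"
  have "(\<Sum>i\<in>{\<lambda>_. False, \<lambda>_. True}. ?w i * (1 - g i)) \<le> (\<Sum>i\<in>UNIV. ?w i * (1 - g i))"
    using p g by (intro sum_mono2) (auto intro!: mult_nonneg_nonneg prod_nonneg)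
  moreover have "(\<lambda>_::'n. False) \<noteq> (\<lambda>_. True)" by (auto simp: fun_eq_iff)
  ultimately have "(\<Prod>h\<in>UNIV. 1 - p h) * (1 - g (\<lambda>_. False)) + (\<Prod>h\<in>UNIV. p h) * (1 - g (\<lambda>_. True))
      \<le> (\<Sum>i\<in>UNIV. ?w i * (1 - g i))" by simp
  also have "\<dots> = bernoulli_mean p (\<lambda>_. 1) - bernoulli_mean p g"
    by (simp add: bernoulli_mean_def algebra_simps sum_subtractf)
  also have "\<dots> = 1 - bernoulli_mean p g" using p by (simp add: bernoulli_mean_const)
  finally show ?thesis by linarith
qed

text \<open>Monotone coupling: realise the smaller Bernoulli variable as the conjunction of the larger one
  with an independent Bernoulli variable of parameter \<open>p h / p' h\<close>.\<close>

lemma bernoulli_mean_coupling: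
  fixes p p' :: "'n::finite \<Rightarrow> real"
  assumes p: "\<And>h. 0 \<le> p h" "\<And>h. p h \<le> p' h" "\<And>h. p' h \<le> 1"
    and g: "\<And>i i'. (\<And>h. i h \<Longrightarrow> i' h) \<Longrightarrow>
              g i + g' i' \<le> 1 + C * exp (- (a * real (card {h. i' h \<and> \<not> i h})))"
  shows "bernoulli_mean p g + bernoulli_mean p' g'
           \<le> 1 + C * (\<Prod>h\<in>UNIV. 1 - (p' h - p h) * (1 - exp (- a)))"
proof -
  define w where "w h = pair_pmf (bernoulli_pmf (p' h)) (bernoulli_pmf (p h / p' h))" for h
  \<comment> \<open>Both \<open>lo\<close> and \<open>fst\<close> send the default
    \<open>(False, False)\<close> to \<open>False\<close>, so \<open>Pi_pmf_map\<close> transports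
    the product law along them.\<close>
  define lo where "lo = (\<lambda>bc :: bool \<times> bool. fst bc \<and> snd bc)"
  define W where "W = Pi_pmf (UNIV :: 'n set) (False, False) w"
  have p': "0 \<le> p' h" "p h \<le> 1" "p h / p' h \<le> 1" "0 \<le> p h / p' h" for h
    using p(1,2,3)[of h] by (auto simp: divide_le_eq intro: order_trans)
  have fst_w: "map_pmf fst (w h) = bernoulli_pmf (p' h)" for h
    by (simp add: w_def map_fst_pair_pmf)
  have w_pmf: "pmf (w h) (b, c) =
      (if b then p' h else 1 - p' h) * (if c then p h / p' h else 1 - p h / p' h)" for h b c
    using p' p(3) by (cases b; cases c) (auto simp: w_def pmf_pair)
  have exp_w: "measure_pmf.expectation (w h) F = (\<Sum>b\<in>UNIV. \<Sum>c\<in>UNIV. pmf (w h) (b, c) * F (b, c))"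
    for h and F :: "bool \<times> bool \<Rightarrow> real"
    by (subst integral_measure_pmf_real[where A = UNIV])
       (auto simp: sum.cartesian_product mult.commute UNIV_Times_UNIV[symmetric]
             simp del: UNIV_Times_UNIV)
  have lo_w: "map_pmf lo (w h) = bernoulli_pmf (p h)" for h
  proof (rule pmf_bool_eqI)
    have "pmf (map_pmf lo (w h)) True = measure_pmf.expectation (w h) (indicator (lo -` {True}))"
      by (simp add: pmf_map)
    also have "\<dots> = p' h * (p h / p' h)"
      unfolding exp_w by (simp add: UNIV_bool w_pmf lo_def indicator_def)
    \<comment> \<open>If \<open>p' h = 0\<close> then \<open>p h = 0\<close> as well, and the
      quotient is 0 by the convention for division.\<close>
    also have "\<dots> = p h" using p(1,2)[of h] by (cases "p' h = 0") auto
    finally show "pmf (map_pmf lo (w h)) True = pmf (bernoulli_pmf (p h)) True"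
      using p(1)[of h] p'(2)[of h] by simp
  qed
  have mean_lo: "bernoulli_mean p g = measure_pmf.expectation W (\<lambda>t. g (lo \<circ> t))"
    unfolding W_def using p(1) p'(2)
    by (simp add: bernoulli_mean_eq_expectation flip: lo_w)
       (simp add: Pi_pmf_map[where dflt = "(False, False)"] lo_def)
  have mean_hi: "bernoulli_mean p' g' = measure_pmf.expectation W (\<lambda>t. g' (fst \<circ> t))"
    unfolding W_def using p(3) p'(1)
    by (simp add: bernoulli_mean_eq_expectation flip: fst_w)
       (simp add: Pi_pmf_map[where dflt = "(False, False)"])
  have int: "integrable (measure_pmf W) F" for F :: "('n \<Rightarrow> bool \<times> bool) \<Rightarrow> real"
    by (rule integrable_measure_pmf_finite) simp
  \<comment> \<open>\<open>J\<close> is the Laplace factor of a single component: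
    \<open>exp (- a)\<close> where the upper draw succeeds and the lower one fails. Independence
    over the components turns the Laplace transform of the number of disagreements into a
    product.\<close>
  define J where "J = (\<lambda>bc :: bool \<times> bool. if fst bc \<and> \<not> snd bc then exp (- a) else 1)"
  have "bernoulli_mean p g + bernoulli_mean p' g'
      = measure_pmf.expectation W (\<lambda>t. g (lo \<circ> t) + g' (fst \<circ> t))"
    unfolding mean_lo mean_hi using int by simp
  also have "\<dots> \<le> measure_pmf.expectation W (\<lambda>t. 1 + C * (\<Prod>h\<in>UNIV. J (t h)))"
  proof (rule integral_mono[OF int int])
    fix t :: "'n \<Rightarrow> bool \<times> bool"
    have "(\<Prod>h\<in>UNIV. J (t h)) = exp (- a) ^ card {h. fst (t h) \<and> \<not> snd (t h)}"
      by (simp add: J_def prod.If_cases)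
    also have "{h. fst (t h) \<and> \<not> snd (t h)} = {h. (fst \<circ> t) h \<and> \<not> (lo \<circ> t) h}"
      by (auto simp: lo_def)
    finally show "g (lo \<circ> t) + g' (fst \<circ> t) \<le> 1 + C * (\<Prod>h\<in>UNIV. J (t h))"
      using g[of "lo \<circ> t" "fst \<circ> t"]
      by (simp add: lo_def mult.commute flip: exp_of_nat_mult)
  qed
  also have "\<dots> = 1 + C * measure_pmf.expectation W (\<lambda>t. \<Prod>h\<in>UNIV. J (t h))"
    using int by simp
  also have "measure_pmf.expectation W (\<lambda>t. \<Prod>h\<in>UNIV. J (t h))
      = (\<Prod>h\<in>UNIV. measure_pmf.expectation (w h) J)"
    unfolding W_def
    by (rule expectation_prod_Pi_pmf) (auto simp: J_def intro!: integrable_measure_pmf_finite)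
  also have "\<dots> = (\<Prod>h\<in>UNIV. 1 - (p' h - p h) * (1 - exp (- a)))"
  proof (rule prod.cong[OF refl])
    fix h
    show "measure_pmf.expectation (w h) J = 1 - (p' h - p h) * (1 - exp (- a))"
      unfolding exp_w using p(1,2)[of h]
      by (cases "p' h = 0") (auto simp: UNIV_bool w_pmf J_def field_simps)
  qed
  finally show ?thesis .
qed

section \<open>Staying probabilities of a cooperative urn\<close>

definition urn_step :: "real \<Rightarrow> real ^ 'n::finite \<Rightarrow> ('n \<Rightarrow> bool) \<Rightarrow> real ^ 'n" where
  "urn_step \<rho> z i = (\<chi> h. (1 - \<rho>) * z $ h + \<rho> * of_bool (i h))"

lemma urn_step_in_cube:
  assumes "z \<in> cbox 0 1" "\<rho> \<in> {0..1}"
  shows "urn_step \<rho> z i \<in> cbox 0 1"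
proof -
  have "0 \<le> (1 - \<rho>) * z $ h + \<rho> * of_bool (i h) \<and> (1 - \<rho>) * z $ h + \<rho> * of_bool (i h) \<le> 1" for h
  proof -
    have z: "0 \<le> z $ h" "z $ h \<le> 1" using assms(1) by (auto simp: mem_box_cart)
    then have "(1 - \<rho>) * z $ h \<le> (1 - \<rho>) * 1" using assms(2) by (intro mult_left_mono) auto
    then show ?thesis using z assms(2) by (cases "i h") auto
  qed
  then show ?thesis by (simp add: urn_step_def mem_box_cart)
qed

text \<open>For ordered draws the difference of the indicators is again an indicator, so the gap is
  driven by a count of disagreements, the quantity whose exponential appears in
  \<open>bernoulli_mean_coupling\<close>.\<close>

lemma sum_urn_step_diff:
  fixes z z' :: "real ^ 'n::finite"
  assumes "\<And>h. i h \<Longrightarrow> i' h"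
  shows "(\<Sum>h\<in>UNIV. urn_step \<rho> z' i' $ h - urn_step \<rho> z i $ h)
       = (1 - \<rho>) * (\<Sum>h\<in>UNIV. z' $ h - z $ h) + \<rho> * real (card {h. i' h \<and> \<not> i h})"
proof -
  have "urn_step \<rho> z' i' $ h - urn_step \<rho> z i $ h
      = (1 - \<rho>) * (z' $ h - z $ h) + \<rho> * of_bool (i' h \<and> \<not> i h)" for h
    using assms[of h] by (cases "i h"; cases "i' h") (auto simp: urn_step_def algebra_simps)
  moreover have "(\<Sum>h\<in>UNIV. of_bool (i' h \<and> \<not> i h)) = real (card {h. i' h \<and> \<not> i h})"
    by simp
  ultimately show ?thesis by (simp only: sum.distrib sum_distrib_left[symmetric])
qed

text \<open>\<open>stay_prob p r U k n z\<close> is the probability that the chain started in \<open>z\<close> at time \<open>n\<close> stays in \<open>U\<close>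
  up to time \<open>n + k\<close>.\<close>

primrec stay_prob ::
    "(real ^ 'n::finite \<Rightarrow> 'n \<Rightarrow> real) \<Rightarrow> (nat \<Rightarrow> real) \<Rightarrow> (real ^ 'n) set \<Rightarrow> nat \<Rightarrow> nat \<Rightarrow> real ^ 'n \<Rightarrow> real"
  where
    "stay_prob p r U 0 = (\<lambda>n z. indicator U z)"
  | "stay_prob p r U (Suc k) = (\<lambda>n z. indicator U z *
       bernoulli_mean (p z) (\<lambda>i. stay_prob p r U k (Suc n) (urn_step (r n) z i)))"

lemma one_plus_sum_le_prod:
  fixes x :: "nat \<Rightarrow> real"
  assumes "\<And>i. 0 \<le> x i"
  shows "1 + (\<Sum>i<n. x i) \<le> (\<Prod>i<n. 1 + x i)"
proof (induction n)
  case (Suc n)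
  have "1 + (\<Sum>i<Suc n. x i) \<le> (1 + (\<Sum>i<n. x i)) * (1 + x n)"
    using assms by (simp add: algebra_simps sum_nonneg)
  also have "\<dots> \<le> (\<Prod>i<Suc n. 1 + x i)"
    using assms[of n] by (simp add: mult_right_mono[OF Suc])
  finally show ?case .
qed simp

text \<open>\<open>expansion\<close> is imposed on the sum over the components because the
  interaction acts through the mean. A step of size \<open>r n\<close> shrinks the old gap by
  \<open>1 - r n\<close>, so the assumption makes the expected total gap of two ordered states in
  \<open>U\<close> grow at least by the factor \<open>1 + \<kappa> * r n\<close>.\<close>

locale cooperative_urn =
  fixes p :: "real ^ 'n::finite \<Rightarrow> 'n \<Rightarrow> real" and r :: "nat \<Rightarrow> real" and U :: "(real ^ 'n) set" and \<kappa> :: real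
  assumes p_range: "\<And>z h. z \<in> cbox 0 1 \<Longrightarrow> p z h \<in> {0..1}"
    and p_mono: "\<And>z z' h. z \<in> cbox 0 1 \<Longrightarrow> z' \<in> cbox 0 1 \<Longrightarrow> (\<And>h. z $ h \<le> z' $ h) \<Longrightarrow> p z h \<le> p z' h"
    and kappa: "0 < \<kappa>" "\<kappa> \<le> 1"
    and expansion: "\<And>z z'. z \<in> cbox 0 1 \<inter> U \<Longrightarrow> z' \<in> cbox 0 1 \<inter> U \<Longrightarrow> (\<And>h. z $ h \<le> z' $ h) \<Longrightarrow>
           (1 + \<kappa>) * (\<Sum>h\<in>UNIV. z' $ h - z $ h) \<le> (\<Sum>h\<in>UNIV. p z' h - p z h)"
    and r_unit: "\<And>n. r n \<in> {0..1}"
begin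

lemma stay_prob_bounds:
  assumes "z \<in> cbox 0 1"
  shows "0 \<le> stay_prob p r U k n z \<and> stay_prob p r U k n z \<le> 1"
  using assms
proof (induction k arbitrary: n z)
  case (Suc k)
  have p: "0 \<le> p z h" "p z h \<le> 1" for h using p_range[OF Suc.prems, of h] by auto
  have IH: "0 \<le> stay_prob p r U k (Suc n) (urn_step (r n) z i)"
      "stay_prob p r U k (Suc n) (urn_step (r n) z i) \<le> 1" for i
    using Suc.IH[OF urn_step_in_cube[OF Suc.prems r_unit]] by auto
  have "0 \<le> bernoulli_mean (p z) (\<lambda>i. stay_prob p r U k (Suc n) (urn_step (r n) z i))"
    using bernoulli_mean_mono[of "p z" "\<lambda>_. 0", OF p IH(1)] p by (simp add: bernoulli_mean_const)
  moreover have "bernoulli_mean (p z) (\<lambda>i. stay_prob p r U k (Suc n) (urn_step (r n) z i)) \<le> 1"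
    using bernoulli_mean_mono[of "p z" _ "\<lambda>_. 1", OF p IH(2)] p by (simp add: bernoulli_mean_const)
  ultimately show ?case by (simp add: indicator_def)
qed (simp add: indicator_def)

text \<open>Under the monotone coupling the gap between two ordered copies grows on average as long as both
  stay in \<open>U\<close>. The gap jumps up by Bernoulli steps, so its Laplace transform at the slowly
  decreasing parameters \<open>s n\<close> is a supermartingale.\<close>

lemma stay_prob_pair:
  fixes s :: "nat \<Rightarrow> real"
  assumes s: "\<And>j. m \<le> j \<Longrightarrow> s (Suc j) * (1 + \<kappa> * r j / 2) = s j"
    and s_pos: "\<And>j. 0 < s j"
    and s_small: "\<And>j. m \<le> j \<Longrightarrow> s (Suc j) * r j \<le> \<kappa> / 4"
    and z: "z \<in> cbox 0 1" "z' \<in> cbox 0 1" "\<And>h. z $ h \<le> z' $ h" and "m \<le> n"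
  shows "stay_prob p r U k n z + stay_prob p r U k n z'
     \<le> 1 + exp (real CARD('n) * s (n + k)) * exp (- (s n * (\<Sum>h\<in>UNIV. z' $ h - z $ h)))"
  using z \<open>m \<le> n\<close>
proof (induction k arbitrary: n z z')
  \<comment> \<open>The total gap of two states in the cube is at most \<open>CARD('n)\<close>, so
    the prefactor with the last parameter makes the right-hand side at least 2.\<close>
  case 0
  have "z' $ h - z $ h \<le> 1" for h
    using 0(1,2) unfolding mem_box_cart by (smt (verit) zero_index one_index)
  then have "(\<Sum>h\<in>UNIV. z' $ h - z $ h) \<le> (\<Sum>h\<in>(UNIV :: 'n set). 1)" by (intro sum_mono)
  then have "s n * (\<Sum>h\<in>UNIV. z' $ h - z $ h) \<le> s n * real CARD('n)"
    using s_pos[of n] by (intro mult_left_mono) auto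
  then have "1 \<le> exp (real CARD('n) * s n) * exp (- (s n * (\<Sum>h\<in>UNIV. z' $ h - z $ h)))"
    by (simp add: mult.commute flip: exp_add)
  then show ?case
    by (simp add: indicator_def)
next
  case (Suc k)
  define G where "G = (\<Sum>h\<in>UNIV. z' $ h - z $ h)"
  have G: "0 \<le> G" using Suc.prems(3) by (simp add: G_def sum_nonneg)
  show ?case
  proof (cases "z \<in> U \<and> z' \<in> U")
    \<comment> \<open>A copy outside \<open>U\<close> has staying probability 0, and the leading 1
      of the bound covers the other copy.\<close>
    case False
    then have "stay_prob p r U (Suc k) n z + stay_prob p r U (Suc k) n z' \<le> 1"
      using stay_prob_bounds[OF Suc.prems(1), of "Suc k" n] stay_prob_bounds[OF Suc.prems(2), of "Suc k" n]
      by auto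
    then show ?thesis by (smt (verit) exp_gt_zero mult_pos_pos)
  next
    case True
    define E where "E = exp (real CARD('n) * s (n + Suc k))"
    define a where "a = s (Suc n) * r n"
    have a: "0 \<le> a" "a \<le> \<kappa> / 4"
      using s_pos[of "Suc n"] r_unit[of n] s_small[OF Suc.prems(4)] by (auto simp: a_def)
    have p: "0 \<le> p z h" "p z h \<le> p z' h" "p z' h \<le> 1" for h
      using p_range[OF Suc.prems(1), of h] p_range[OF Suc.prems(2), of h] p_mono[OF Suc.prems(1-3), of h]
      by auto
    have "stay_prob p r U (Suc k) n z + stay_prob p r U (Suc k) n z'
        = bernoulli_mean (p z) (\<lambda>i. stay_prob p r U k (Suc n) (urn_step (r n) z i))
        + bernoulli_mean (p z') (\<lambda>i. stay_prob p r U k (Suc n) (urn_step (r n) z' i))"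
      using True by simp
    also have "\<dots> \<le> 1 + (E * exp (- (s (Suc n) * (1 - r n) * G))) *
        (\<Prod>h\<in>UNIV. 1 - (p z' h - p z h) * (1 - exp (- a)))"
    proof (rule bernoulli_mean_coupling[OF p])
      fix i i' :: "'n \<Rightarrow> bool" assume ii': "\<And>h. i h \<Longrightarrow> i' h"
      have "(1 - r n) * z $ h \<le> (1 - r n) * z' $ h" for h
        using Suc.prems(3) r_unit[of n] by (intro mult_left_mono) auto
      then have le: "urn_step (r n) z i $ h \<le> urn_step (r n) z' i' $ h" for h
        using ii'[of h] r_unit[of n]
        by (cases "i h"; cases "i' h") (auto simp: urn_step_def intro: add_increasing2)
      have "stay_prob p r U k (Suc n) (urn_step (r n) z i) + stay_prob p r U k (Suc n) (urn_step (r n) z' i')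
          \<le> 1 + E * exp (- (s (Suc n) * ((1 - r n) * G + r n * real (card {h. i' h \<and> \<not> i h}))))"
        using Suc.IH[OF urn_step_in_cube[OF Suc.prems(1) r_unit] urn_step_in_cube[OF Suc.prems(2) r_unit] le,
            of "Suc n"] Suc.prems(4)
        by (simp add: E_def G_def sum_urn_step_diff ii')
      also have "\<dots> = 1 + E * exp (- (s (Suc n) * (1 - r n) * G)) * exp (- (a * real (card {h. i' h \<and> \<not> i h})))"
        by (simp add: a_def distrib_left mult.assoc mult_exp_exp)
      finally show "stay_prob p r U k (Suc n) (urn_step (r n) z i)
          + stay_prob p r U k (Suc n) (urn_step (r n) z' i')
          \<le> 1 + E * exp (- (s (Suc n) * (1 - r n) * G)) * exp (- (a * real (card {h. i' h \<and> \<not> i h})))" .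
    qed
    \<comment> \<open>A Bernoulli jump contributes \<open>1 - exp (- a)\<close> instead of
      \<open>a\<close>, which is at least a / (1 + a). Because \<open>a\<close> is at most \<kappa>
      / 4, the expansion rate \<open>1 + \<kappa>\<close> still leaves
      \<open>1 + \<kappa> / 2\<close> after this loss.\<close>
    also have "(\<Prod>h\<in>UNIV. 1 - (p z' h - p z h) * (1 - exp (- a))) \<le> exp (- (a * (1 + \<kappa> / 2) * G))"
    proof -
      define t where "t = 1 - exp (- a)"
      have t: "0 \<le> t" "t \<le> 1" using a by (auto simp: t_def)
      have "(1 + a) * exp (- a) \<le> 1"
        using exp_ge_add_one_self[of a] by (simp add: exp_minus divide_simps)
      then have ta: "a \<le> t * (1 + a)" by (simp add: t_def algebra_simps)
      have "(1 + \<kappa> / 2) * (1 + a) \<le> 1 + \<kappa>"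
      proof -
        have "(1 + \<kappa> / 2) * (1 + a) \<le> (1 + \<kappa> / 2) * (1 + \<kappa> / 4)"
          using a kappa by (intro mult_left_mono) auto
        also have "\<dots> = 1 + 3 / 4 * \<kappa> + \<kappa> * \<kappa> / 8" by (simp add: algebra_simps)
        also have "\<dots> \<le> 1 + \<kappa>" using mult_left_le[of \<kappa> \<kappa>] kappa by linarith
        finally show ?thesis .
      qed
      from mult_left_mono[OF this t(1)]
      have "t * (1 + a) * (1 + \<kappa> / 2) \<le> t * (1 + \<kappa>)" by (simp only: mult_ac)
      moreover have "a * (1 + \<kappa> / 2) \<le> t * (1 + a) * (1 + \<kappa> / 2)"
        using kappa by (intro mult_right_mono[OF ta]) simp
      ultimately have "a * (1 + \<kappa> / 2) * G \<le> t * (1 + \<kappa>) * G"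
        using G by (intro mult_right_mono) linarith+
      also have "\<dots> = t * ((1 + \<kappa>) * G)" by (rule mult.assoc)
      also have "\<dots> \<le> t * (\<Sum>h\<in>UNIV. p z' h - p z h)"
        unfolding G_def using expansion[of z z'] True Suc.prems by (intro mult_left_mono t) auto
      also have "\<dots> = (\<Sum>h\<in>UNIV. (p z' h - p z h) * t)"
        by (simp only: sum_distrib_left mult.commute[of t])
      finally have *: "a * (1 + \<kappa> / 2) * G \<le> (\<Sum>h\<in>UNIV. (p z' h - p z h) * t)" .
      have "(\<Prod>h\<in>UNIV. 1 - (p z' h - p z h) * t) \<le> (\<Prod>h\<in>UNIV. exp (- ((p z' h - p z h) * t)))"
      proof (rule prod_mono)
        fix h
        have "(p z' h - p z h) * t \<le> 1 * 1" using p[of h] t by (intro mult_mono) auto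
        then show "0 \<le> 1 - (p z' h - p z h) * t \<and>
            1 - (p z' h - p z h) * t \<le> exp (- ((p z' h - p z h) * t))"
          using exp_ge_add_one_self[of "- ((p z' h - p z h) * t)"] by auto
      qed
      also have "\<dots> = exp (- (\<Sum>h\<in>UNIV. (p z' h - p z h) * t))"
        by (simp add: exp_sum flip: sum_negf)
      also have "\<dots> \<le> exp (- (a * (1 + \<kappa> / 2) * G))" using * by simp
      finally show ?thesis unfolding t_def .
    qed
    also have "E * exp (- (s (Suc n) * (1 - r n) * G)) * exp (- (a * (1 + \<kappa> / 2) * G))
        = E * exp (- (s (Suc n) * (1 - r n) * G + a * (1 + \<kappa> / 2) * G))"
      by (simp add: mult.assoc mult_exp_exp)
    \<comment> \<open>The contraction 1 - r and the growth r (1 + \<kappa> / 2) add up to 1 +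
      \<kappa> r / 2, exactly the factor by which \<open>s\<close> decreases in one step.\<close>
    also have "s (Suc n) * (1 - r n) * G + a * (1 + \<kappa> / 2) * G = s (Suc n) * (1 + \<kappa> * r n / 2) * G"
      unfolding a_def by algebra
    also have "s (Suc n) * (1 + \<kappa> * r n / 2) = s n" by (rule s[OF Suc.prems(4)])
    finally show ?thesis by (simp add: E_def G_def)
  qed
qed

text \<open>The first draw is split off: from any state, all failures and all successes lead to
  ordered states with gap \<open>r n\<close> in every component, and each of the two draws has
  probability at least \<open>c ^ CARD('n)\<close>. With \<open>s\<close> of order n at the start,
  its product with the gap is bounded below; once \<open>s\<close> has decreased to at most a
  quarter of \<open>c0\<close>, the bound of \<open>stay_prob_pair\<close> is below 2 by a fixed
  margin. The horizon \<open>k\<close> may depend on n, but neither it nor \<delta> depends on the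
  state.\<close>

lemma stay_prob_uniformly_small:
  assumes r_lim: "(\<lambda>n. real n * r n) \<longlonglongrightarrow> 1" and r_sum: "\<not> summable r"
    and c: "0 < c" "\<And>z h. z \<in> cbox 0 1 \<Longrightarrow> p z h \<in> {c..1 - c}"
  shows "\<exists>\<delta>>0. \<forall>\<^sub>F n in sequentially. \<exists>k. \<forall>z\<in>cbox 0 1. stay_prob p r U k n z \<le> 1 - \<delta>"
proof -
  let ?N = "real CARD('n)"
  \<comment> \<open>As j r(j) < 2 for late j and \<open>s\<close> is at most c0 (n + 1), the value
    \<kappa> / 8 gives the bound \<kappa> / 4 on \<open>s (Suc j) * r j\<close> that
    \<open>stay_prob_pair\<close> demands.\<close>
  define c0 where "c0 = \<kappa> / 8"
  have c0: "0 < c0" using kappa by (simp add: c0_def)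
  define \<delta> where "\<delta> = c ^ CARD('n) * (1 - exp (- (c0 / 4)))"
  have "0 < \<delta>" using c(1) c0 by (simp add: \<delta>_def)
  have "\<forall>\<^sub>F n in sequentially. 1 / 2 < real n * r n"
    using order_tendstoD(1)[OF r_lim, of "1 / 2"] by simp
  moreover have "\<forall>\<^sub>F n in sequentially. real n * r n < 2"
    using order_tendstoD(2)[OF r_lim, of 2] by simp
  then have "\<forall>\<^sub>F n in sequentially. \<forall>j\<ge>n. real j * r j < 2"
    by (rule eventually_all_ge_at_top)
  ultimately have "\<forall>\<^sub>F n in sequentially. \<exists>k. \<forall>z\<in>cbox 0 1. stay_prob p r U k n z \<le> 1 - \<delta>"
  proof eventually_elim
    case (elim n)
    define P where "P k = (\<Prod>i<k. 1 + \<kappa> * r (Suc n + i) / 2)" for k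
    define s where "s j = c0 * real (Suc n) / P (j - Suc n)" for j
    have x: "0 \<le> \<kappa> * r j / 2" for j using kappa r_unit[of j] by simp
    have P1: "1 \<le> P k" for k
      unfolding P_def using x by (intro prod_ge_1) simp
    have s_pos: "0 < s j" for j
      using P1[of "j - Suc n"] c0 by (simp add: s_def)
    have s_le: "s j \<le> c0 * real (Suc n)" for j
      using P1[of "j - Suc n"] c0 by (simp add: s_def divide_le_eq mult_left_mono)
    have s_rec: "s (Suc j) * (1 + \<kappa> * r j / 2) = s j" if "Suc n \<le> j" for j
    proof -
      have "Suc j - Suc n = Suc (j - Suc n)" using that by simp
      then have "P (Suc j - Suc n) = P (j - Suc n) * (1 + \<kappa> * r j / 2)"
        by (simp only: P_def prod.lessThan_Suc le_add_diff_inverse[OF that])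
      then show ?thesis unfolding s_def using x[of j] P1[of "j - Suc n"] by (simp del: diff_Suc_Suc)
    qed
    have s_small: "s (Suc j) * r j \<le> \<kappa> / 4" if "Suc n \<le> j" for j
    proof -
      have "s (Suc j) * r j \<le> c0 * real (Suc n) * r j"
        using s_le r_unit[of j] by (intro mult_right_mono) auto
      also have "\<dots> \<le> c0 * real j * r j"
        using that c0 r_unit[of j] by (intro mult_right_mono mult_left_mono) auto
      also have "\<dots> \<le> c0 * 2"
        using elim(2)[rule_format, of j] that c0 by (simp add: mult.assoc)
      finally show ?thesis by (simp add: c0_def)
    qed
    \<comment> \<open>The product is unbounded because \<open>r\<close> is not summable. The level 4
      (n + 1) brings \<open>s\<close> from c0 (n + 1) down to c0 / 4, half of the c0 / 2 per
      component that the initial gap contributes.\<close>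
    have "\<exists>k. 4 * real (Suc n) \<le> P k"
    proof (rule ccontr)
      assume "\<not> ?thesis"
      then have P: "P k < 4 * real (Suc n)" for k by (simp add: not_le)
      have "summable (\<lambda>i. \<kappa> * r (Suc n + i) / 2)"
      proof (rule summableI_nonneg_bounded)
        show "(\<Sum>i<k. \<kappa> * r (Suc n + i) / 2) \<le> 4 * real (Suc n)" for k
          using one_plus_sum_le_prod[of "\<lambda>i. \<kappa> * r (Suc n + i) / 2" k] x P[of k] by (simp add: P_def)
      qed (use x in auto)
      then have "summable (\<lambda>i. \<kappa> / 2 * r (i + Suc n))" by (simp add: add.commute)
      then have "summable (\<lambda>i. r (i + Suc n))" using kappa summable_mult_D by fastforce
      then show False using r_sum summable_iff_shift[of r "Suc n"] by blast
    qed
    then obtain k where k: "4 * real (Suc n) \<le> P k" by blast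
    have s_end: "s (Suc n + k) \<le> c0 / 4"
      using k P1[of k] c0 by (simp add: s_def divide_le_eq)
    have "stay_prob p r U (Suc k) n z \<le> 1 - \<delta>" if z: "z \<in> cbox 0 1" for z
    proof -
      let ?g = "\<lambda>i. stay_prob p r U k (Suc n) (urn_step (r n) z i)"
      let ?no = "\<lambda>_::'n. False" and ?yes = "\<lambda>_::'n. True"
      have cube: "urn_step (r n) z i \<in> cbox 0 1" for i
        by (rule urn_step_in_cube[OF z r_unit])
      have g: "0 \<le> ?g i" "?g i \<le> 1" for i using stay_prob_bounds[OF cube] by auto
      have p: "0 \<le> p z h" "p z h \<le> 1" for h using p_range[OF z, of h] by auto
      have "s (Suc n) * (\<Sum>h\<in>UNIV. urn_step (r n) z ?yes $ h - urn_step (r n) z ?no $ h)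
          = c0 * ?N * (real (Suc n) * r n)"
        by (simp add: urn_step_def s_def P_def)
      also have "\<dots> \<ge> c0 * ?N * (1 / 2)"
        using elim(1) c0 r_unit[of n] by (intro mult_left_mono) (auto simp: algebra_simps)
      finally have gap: "c0 * ?N / 2 \<le> s (Suc n) *
          (\<Sum>h\<in>UNIV. urn_step (r n) z ?yes $ h - urn_step (r n) z ?no $ h)" by simp
      have "?g ?no + ?g ?yes \<le> 1 + exp (?N * s (Suc n + k)) *
          exp (- (s (Suc n) * (\<Sum>h\<in>UNIV. urn_step (r n) z ?yes $ h - urn_step (r n) z ?no $ h)))"
        by (rule stay_prob_pair[of "Suc n" s, OF s_rec s_pos s_small cube cube _ order_refl])
           (use r_unit[of n] in \<open>auto simp: urn_step_def\<close>)
      also have "\<dots> \<le> 1 + exp (?N * (c0 / 4)) * exp (- (c0 * ?N / 2))"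
        using s_end gap by (intro add_left_mono mult_mono) auto
      also have "\<dots> = 1 + exp (- (?N * (c0 / 4)))"
        unfolding mult_exp_exp by (simp add: algebra_simps)
      also have "\<dots> \<le> 1 + exp (- (1 * (c0 / 4)))"
        using c0 one_le_card_finite[where 'a = 'n]
        by (simp add: divide_right_mono del: zero_less_card_finite)
      finally have pair: "?g ?no + ?g ?yes \<le> 1 + exp (- (c0 / 4))" by simp
      have no: "c ^ CARD('n) \<le> (\<Prod>h\<in>UNIV. 1 - p z h)"
        using prod_mono[of UNIV "\<lambda>_. c" "\<lambda>h. 1 - p z h"] c(1) c(2)[OF z] by (auto simp: algebra_simps)
      have yes: "c ^ CARD('n) \<le> (\<Prod>h\<in>UNIV. p z h)"
        using prod_mono[of UNIV "\<lambda>_. c" "\<lambda>h. p z h"] c(1) c(2)[OF z] by auto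
      have "stay_prob p r U (Suc k) n z \<le> bernoulli_mean (p z) ?g"
        using bernoulli_mean_mono[of "p z" "\<lambda>_. 0" ?g, OF p g(1)] p
        by (simp add: indicator_def bernoulli_mean_const)
      also have "\<dots> \<le> 1 - (\<Prod>h\<in>UNIV. 1 - p z h) * (1 - ?g ?no) - (\<Prod>h\<in>UNIV. p z h) * (1 - ?g ?yes)"
        by (rule bernoulli_mean_extremes[OF p g(2)])
      also have "\<dots> \<le> 1 - c ^ CARD('n) * (1 - ?g ?no) - c ^ CARD('n) * (1 - ?g ?yes)"
        using mult_right_mono[OF no, of "1 - ?g ?no"] mult_right_mono[OF yes, of "1 - ?g ?yes"] g(2)
        by (smt (verit))
      also have "\<dots> = 1 - c ^ CARD('n) * (2 - (?g ?no + ?g ?yes))" by (simp add: algebra_simps)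
      also have "\<dots> \<le> 1 - c ^ CARD('n) * (1 - exp (- (c0 / 4)))"
        using pair c(1) by (intro diff_left_mono mult_left_mono) auto
      finally show ?thesis by (simp add: \<delta>_def)
    qed
    then show ?case by blast
  qed
  with \<open>0 < \<delta>\<close> show ?thesis by blast
qed

end

section \<open>Zeros of the drift\<close>

text \<open>In terms of the centred sum and the difference both squares enter negatively, so for
  \<theta> > 1/2 the chord slopes are bounded by 3/2 (2 \<theta> - 1) = 3 \<theta> - 3/2, the slope
  at 1/2. This is the quantity in the hypothesis on \<theta>.\<close>

lemma f_theta_diff:
  "f_theta \<theta> x - f_theta \<theta> y
     = (2 * \<theta> - 1) * (x - y) * (3 / 2 - 3 / 2 * (x + y - 1)\<^sup>2 - (x - y)\<^sup>2 / 2)"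
  unfolding f_theta_def by (simp add: field_simps power2_eq_square power3_eq_cube)

text \<open>Strict contraction of differences in the borderline case too, where the linear part of the
  contraction vanishes at \<open>1/2\<close>.\<close>

lemma f_theta_contraction:
  assumes "0 \<le> \<gamma> * (2 * \<theta> - 1)" "\<gamma> * (3 * \<theta> - 3 / 2) \<le> 1" "y \<le> x"
  shows "\<gamma> * (f_theta \<theta> x - f_theta \<theta> y) \<le> (x - y) - \<gamma> * (2 * \<theta> - 1) * (x - y) ^ 3 / 2"
proof -
  let ?k = "\<gamma> * (2 * \<theta> - 1)"
  have "\<gamma> * (f_theta \<theta> x - f_theta \<theta> y)
      = ?k * (x - y) * (3 / 2 - 3 / 2 * (x + y - 1)\<^sup>2 - (x - y)\<^sup>2 / 2)"
    by (simp add: f_theta_diff)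
  also have "\<dots> \<le> ?k * (x - y) * (3 / 2 - (x - y)\<^sup>2 / 2)"
    using assms(3) by (intro mult_left_mono mult_nonneg_nonneg[OF assms(1)]) auto
  also have "\<dots> = \<gamma> * (3 * \<theta> - 3 / 2) * (x - y) - ?k * (x - y) ^ 3 / 2"
    by (simp add: field_simps power2_eq_square power3_eq_cube)
  also have "\<dots> \<le> 1 * (x - y) - ?k * (x - y) ^ 3 / 2"
    using assms(2,3) by (intro diff_right_mono mult_right_mono) auto
  finally show ?thesis by simp
qed

text \<open>The divided differences over (x, y) and (y, z) vanish, and comparing them fixes the sum
  of the three roots at 3/2. The slope at y is then 2k (y - x)(z - y), as for the factorised
  cubic.\<close>

lemma cubic_middle_root:
  fixes x y z k b c :: real
  assumes "0 < k" "x < y" "y < z"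
    and "- 2 * k * x ^ 3 + 3 * k * x\<^sup>2 - b * x + c = 0"
    and "- 2 * k * y ^ 3 + 3 * k * y\<^sup>2 - b * y + c = 0"
    and "- 2 * k * z ^ 3 + 3 * k * z\<^sup>2 - b * z + c = 0"
  shows "0 < 6 * k * y * (1 - y) - b"
proof -
  define A where "A = - 2 * k * (x\<^sup>2 + x * y + y\<^sup>2) + 3 * k * (x + y) - b"
  define B where "B = - 2 * k * (y\<^sup>2 + y * z + z\<^sup>2) + 3 * k * (y + z) - b"
  have "(x - y) * A = 0" "(y - z) * B = 0"
    using assms(4-6) unfolding A_def B_def by algebra+
  then have AB: "A = 0" "B = 0" using assms(2,3) by auto
  have "k * (x - z) * (3 - 2 * (x + y + z)) = A - B" unfolding A_def B_def by algebra
  then have "2 * (x + y + z) = 3" using AB assms(1-3) by simp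
  then have z: "z = 3 / 2 - x - y" by simp
  have "6 * k * y * (1 - y) - b = A - 2 * k * (y - x) * (y - z)"
    unfolding A_def z by (simp add: field_simps power2_eq_square)
  moreover have "0 < k * (y - x) * (z - y)" using assms(1-3) by (intro mult_pos_pos) auto
  ultimately show ?thesis using AB by (simp add: algebra_simps)
qed

lemma card_le_2_if_no_three:
  fixes S :: "'a::linorder set"
  assumes "\<And>x y z. x \<in> S \<Longrightarrow> y \<in> S \<Longrightarrow> z \<in> S \<Longrightarrow> x < y \<Longrightarrow> y < z \<Longrightarrow> False"
  shows "finite S \<and> card S \<le> 2"
proof (rule ccontr)
  assume "\<not> ?thesis"
  then have "\<exists>T\<subseteq>S. finite T \<and> card T = 3"
    using infinite_arbitrarily_large[of S 3] obtain_subset_with_card_n[of 3 S] by (metis not_less_eq_eq eval_nat_numeral(2,3) BitM.simps(1) semiring_norm(26,28))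
  then obtain T where T: "T \<subseteq> S" "finite T" "card T = 3" by blast
  have "\<exists>x y z. l = [x, y, z]" if "length l = 3" for l :: "'a list"
    using that by (auto simp: numeral_3_eq_3 length_Suc_conv)
  then obtain x y z where xyz: "sorted_list_of_set T = [x, y, z]" using T by fastforce
  have "x < y" "y < z" using sorted_list_of_set.strict_sorted_key_list_of_set[of T] xyz by auto
  moreover have "{x, y, z} \<subseteq> S" using T xyz set_sorted_list_of_set[OF T(2)] by auto
  ultimately show False using assms[of x y z] by auto
qed

section \<open>The scalar drift on the diagonal and the Jacobian\<close>

definition diag_drift :: "real \<Rightarrow> real \<Rightarrow> real \<Rightarrow> real \<Rightarrow> real \<Rightarrow> real" where
  "diag_drift \<alpha> \<beta> q \<theta> x = \<alpha> * x + \<beta> * q + (1 - \<alpha> - \<beta>) * f_theta \<theta> x - x"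

text \<open>The derivative of \<open>diag_drift\<close> in \<open>x\<close>; at the point
  \<open>x *\<^sub>R 1\<close> it is also the eigenvalue of the Jacobian of the full drift in the
  diagonal direction.\<close>

definition diag_slope :: "real \<Rightarrow> real \<Rightarrow> real \<Rightarrow> real \<Rightarrow> real" where
  "diag_slope \<alpha> \<beta> \<theta> x = \<alpha> + (1 - \<alpha> - \<beta>) * ((2 * \<theta> - 1) * (6 * x * (1 - x))) - 1"

lemma diag_drift_cubic:
  "diag_drift \<alpha> \<beta> q \<theta> x = - 2 * ((1 - \<alpha> - \<beta>) * (2 * \<theta> - 1)) * x ^ 3
     + 3 * ((1 - \<alpha> - \<beta>) * (2 * \<theta> - 1)) * x\<^sup>2 - (1 - \<alpha>) * x + (\<beta> * q + (1 - \<alpha> - \<beta>) * (1 - \<theta>))"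
  unfolding diag_drift_def f_theta_def by (simp add: algebra_simps)

lemma finite_diag_drift_zeros:
  assumes "0 < (1 - \<alpha> - \<beta>) * (2 * \<theta> - 1)"
  shows "finite {x. diag_drift \<alpha> \<beta> q \<theta> x = 0}"
proof -
  let ?k = "(1 - \<alpha> - \<beta>) * (2 * \<theta> - 1)"
  let ?p = "[: \<beta> * q + (1 - \<alpha> - \<beta>) * (1 - \<theta>), - (1 - \<alpha>), 3 * ?k, - 2 * ?k :]"
  have "?p \<noteq> 0" using assms by auto
  moreover have "diag_drift \<alpha> \<beta> q \<theta> x = poly ?p x" for x
    unfolding diag_drift_cubic by (simp add: power2_eq_square power3_eq_cube algebra_simps)
  ultimately show ?thesis using poly_roots_finite[of ?p] by simp
qed

lemma stable_diag_zeros_card: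
  assumes "0 < (1 - \<alpha> - \<beta>) * (2 * \<theta> - 1)"
  shows "finite {x. diag_drift \<alpha> \<beta> q \<theta> x = 0 \<and> diag_slope \<alpha> \<beta> \<theta> x \<le> 0}"
    and "card {x. diag_drift \<alpha> \<beta> q \<theta> x = 0 \<and> diag_slope \<alpha> \<beta> \<theta> x \<le> 0} \<le> 2"
proof -
  let ?S = "{x. diag_drift \<alpha> \<beta> q \<theta> x = 0 \<and> diag_slope \<alpha> \<beta> \<theta> x \<le> 0}"
  have "finite ?S \<and> card ?S \<le> 2"
  proof (rule card_le_2_if_no_three)
    fix x y z assume "x \<in> ?S" "y \<in> ?S" "z \<in> ?S" "x < y" "y < z"
    then have "0 < 6 * ((1 - \<alpha> - \<beta>) * (2 * \<theta> - 1)) * y * (1 - y) - (1 - \<alpha>)"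
      by (intro cubic_middle_root[OF assms, of x y z _ "\<beta> * q + (1 - \<alpha> - \<beta>) * (1 - \<theta>)"])
         (auto simp only: diag_drift_cubic mem_Collect_eq)
    also have "\<dots> = diag_slope \<alpha> \<beta> \<theta> y" by (simp add: diag_slope_def)
    finally show False using \<open>y \<in> ?S\<close> by simp
  qed
  then show "finite ?S" "card ?S \<le> 2" by auto
qed

lemma mean_scaleR_one: "mean (x *\<^sub>R 1 :: real ^ 'n::finite) = x"
  by (simp add: mean_def)

lemma drift_diag:
  "drift \<alpha> \<beta> q (f_theta \<theta>) (x *\<^sub>R 1 :: real ^ 'n::finite) = diag_drift \<alpha> \<beta> q \<theta> x *\<^sub>R 1"
  by (simp add: drift_def diag_drift_def mean_scaleR_one vec_eq_iff)

lemma drift_has_derivative: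
  "(drift \<alpha> \<beta> q (f_theta \<theta>) has_derivative
     (\<lambda>v. \<chi> h. \<alpha> * mean v + (1 - \<alpha> - \<beta>) * ((2 * \<theta> - 1) * (6 * z $ h * (1 - z $ h))) * v $ h - v $ h))
   (at (z :: real ^ 'n::finite) within S)"
proof -
  have nth: "((\<lambda>z :: real ^ 'n. z $ h) has_derivative (\<lambda>v. v $ h)) (at z within S)" for h
    by (rule bounded_linear.has_derivative[OF bounded_linear_vec_nth has_derivative_ident])
  have m: "(mean has_derivative mean) (at z within S)"
    unfolding mean_def[abs_def] by (auto intro!: derivative_eq_intros nth)
  have f: "((\<lambda>z. f_theta \<theta> (z $ h)) has_derivative (\<lambda>v. (2 * \<theta> - 1) * (6 * z $ h * (1 - z $ h)) * v $ h))
      (at z within S)" for h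
    using has_derivative_compose[OF nth f_theta_has_derivative[unfolded has_field_derivative_def, of \<theta> _ UNIV]]
    by simp
  have "((\<lambda>z. \<alpha> * mean z + \<beta> * q + (1 - \<alpha> - \<beta>) * f_theta \<theta> (z $ h) - z $ h) has_derivative
     (\<lambda>v. \<alpha> * mean v + (1 - \<alpha> - \<beta>) * ((2 * \<theta> - 1) * (6 * z $ h * (1 - z $ h))) * v $ h - v $ h))
     (at z within S)" for h
    by (auto intro!: derivative_eq_intros nth m f simp: mult.assoc)
  then show ?thesis
    unfolding drift_def[abs_def]
    by (subst has_derivative_componentwise_within) (auto simp: Basis_vec_def inner_axis)
qed

text \<open>The cube has positive length in every coordinate, so the derivative within it is unique
  even at boundary points and the matrix is the one of the derivative computed
  componentwise.\<close>

lemma jacobian_drift_mult: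
  fixes z v :: "real ^ 'n::finite"
  assumes "z \<in> cbox 0 1"
  shows "jacobian (drift \<alpha> \<beta> q (f_theta \<theta>)) (at z within cbox 0 1) *v v =
    (\<chi> h. \<alpha> * mean v + (1 - \<alpha> - \<beta>) * ((2 * \<theta> - 1) * (6 * z $ h * (1 - z $ h))) * v $ h - v $ h)"
proof -
  let ?D = "\<lambda>v :: real ^ 'n.
    \<chi> h. \<alpha> * mean v + (1 - \<alpha> - \<beta>) * ((2 * \<theta> - 1) * (6 * z $ h * (1 - z $ h))) * v $ h - v $ h"
  have D: "(drift \<alpha> \<beta> q (f_theta \<theta>) has_derivative ?D) (at z within cbox 0 1)"
    by (rule drift_has_derivative)
  have "frechet_derivative (drift \<alpha> \<beta> q (f_theta \<theta>)) (at z within cbox 0 1) = ?D"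
    by (rule frechet_derivative_within_cbox[OF _ assms D])
       (auto simp: Basis_vec_def inner_axis)
  moreover have "linear ?D" using D by (rule has_derivative_linear)
  ultimately show ?thesis unfolding jacobian_def by (simp add: matrix_works)
qed

text \<open>At \<open>x *\<^sub>R 1\<close> the Jacobian is the slope minus \<alpha> times the
  identity, plus \<alpha> times averaging. Its eigenvalues are the slope on constant vectors and the
  slope minus \<alpha> on vectors of mean 0; as \<alpha> \<ge> 0, the sign of the slope decides.
  Zeros off the diagonal are excluded by the cubic term of
  \<open>f_theta_contraction\<close>.\<close>

lemma stable_zero_points_diag:
  fixes F :: "real ^ 'n::finite \<Rightarrow> real ^ 'n"
  assumes F: "F = drift \<alpha> \<beta> q (f_theta \<theta>)"
    and k: "0 < (1 - \<alpha> - \<beta>) * (2 * \<theta> - 1)" and le: "(1 - \<alpha> - \<beta>) * (3 * \<theta> - 3 / 2) \<le> 1"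
    and "0 \<le> \<alpha>"
  shows "stable_zero_points F = (\<lambda>x. x *\<^sub>R 1) `
     {x \<in> {0..1}. diag_drift \<alpha> \<beta> q \<theta> x = 0 \<and> diag_slope \<alpha> \<beta> \<theta> x \<le> 0}"
proof -
  have stable: "(\<forall>c. eigenvalue (jacobian F (at (x *\<^sub>R 1) within cbox 0 1)) c \<longrightarrow> c \<le> 0)
      \<longleftrightarrow> diag_slope \<alpha> \<beta> \<theta> x \<le> 0" if "x \<in> {0..1}" for x
  proof -
    let ?J = "jacobian F (at (x *\<^sub>R 1) within cbox 0 1)"
    have "x *\<^sub>R 1 \<in> cbox 0 (1 :: real ^ 'n)" using that by (simp add: mem_box_cart)
    from jacobian_drift_mult[OF this, of \<alpha> \<beta> q \<theta>, folded F]
    have J: "(?J *v v) $ h = \<alpha> * mean v + (diag_slope \<alpha> \<beta> \<theta> x - \<alpha>) * v $ h" for v h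
      by (simp add: diag_slope_def algebra_simps)
    have "?J *v 1 = diag_slope \<alpha> \<beta> \<theta> x *\<^sub>R 1"
      by (simp add: vec_eq_iff J mean_def)
    then have "eigenvalue ?J (diag_slope \<alpha> \<beta> \<theta> x)"
      unfolding eigenvalue_def by (intro exI[of _ 1]) (simp add: vec_eq_iff)
    moreover have "c \<le> max (diag_slope \<alpha> \<beta> \<theta> x) (diag_slope \<alpha> \<beta> \<theta> x - \<alpha>)" if c: "eigenvalue ?J c" for c
    proof -
      obtain v where v: "v \<noteq> 0" "?J *v v = c *\<^sub>R v" using c by (auto simp: eigenvalue_def)
      have comp: "c * v $ h = \<alpha> * mean v + (diag_slope \<alpha> \<beta> \<theta> x - \<alpha>) * v $ h" for h
        using arg_cong[OF v(2), of "\<lambda>w. w $ h"] J[of v h] by simp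
      \<comment> \<open>For an eigenvector of mean 0 one nonzero component identifies
        \<open>c\<close>; otherwise summing over the components does.\<close>
      show ?thesis
      proof (cases "mean v = 0")
        case True
        obtain h where "v $ h \<noteq> 0" using v(1) by (auto simp: vec_eq_iff)
        then show ?thesis using comp[of h] True by simp
      next
        case False
        have "c * (\<Sum>h\<in>UNIV. v $ h) = (\<Sum>h\<in>UNIV. \<alpha> * mean v + (diag_slope \<alpha> \<beta> \<theta> x - \<alpha>) * v $ h)"
          unfolding sum_distrib_left by (rule sum.cong[OF refl comp])
        moreover have S: "(\<Sum>h\<in>UNIV. v $ h) = real CARD('n) * mean v" by (simp add: mean_def)
        ultimately have "c * (real CARD('n) * mean v)
            = real CARD('n) * (\<alpha> * mean v) + (diag_slope \<alpha> \<beta> \<theta> x - \<alpha>) * (real CARD('n) * mean v)"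
          by (simp only: S sum.distrib sum_distrib_left[symmetric] sum_constant mult.left_commute)
        then have "real CARD('n) * (c * mean v) = real CARD('n) * (diag_slope \<alpha> \<beta> \<theta> x * mean v)"
          by (simp add: algebra_simps)
        then have "c * mean v = diag_slope \<alpha> \<beta> \<theta> x * mean v" by simp
        then show ?thesis using False by simp
      qed
    qed
    ultimately show ?thesis using \<open>0 \<le> \<alpha>\<close> by force
  qed
  have diagonal: "\<exists>x\<in>{0..1}. z = x *\<^sub>R 1" if "z \<in> cbox 0 1" "F z = 0" for z
  proof -
    \<comment> \<open>At a zero the mean and the constant term cancel in the difference of two
      components.\<close>
    have eq: "(1 - \<alpha> - \<beta>) * (f_theta \<theta> (z $ h) - f_theta \<theta> (z $ j)) = z $ h - z $ j" for h j
      using arg_cong[OF that(2), of "\<lambda>w. w $ h"] arg_cong[OF that(2), of "\<lambda>w. w $ j"]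
      by (simp add: F drift_def algebra_simps)
    have le_comp: "z $ h \<le> z $ j" for h j
    proof (rule ccontr)
      assume "\<not> ?thesis"
      then have lt: "z $ j < z $ h" by simp
      from f_theta_contraction[OF less_imp_le[OF k] le less_imp_le[OF this]] eq[of h j]
      have "(1 - \<alpha> - \<beta>) * (2 * \<theta> - 1) * (z $ h - z $ j) ^ 3 \<le> 0" by simp
      moreover have "0 < (1 - \<alpha> - \<beta>) * (2 * \<theta> - 1) * (z $ h - z $ j) ^ 3"
        using lt by (intro mult_pos_pos[OF k]) auto
      ultimately show False by linarith
    qed
    have "z $ h = z $ j" for h j by (rule antisym[OF le_comp le_comp])
    then have "z = z $ undefined *\<^sub>R 1" by (simp add: vec_eq_iff)
    moreover have "z $ undefined \<in> {0..1}" using that(1) by (simp add: mem_box_cart)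
    ultimately show ?thesis by blast
  qed
  have F_diag: "F (x *\<^sub>R 1) = diag_drift \<alpha> \<beta> q \<theta> x *\<^sub>R 1" for x
    unfolding F by (rule drift_diag)
  show ?thesis
  proof (intro equalityI subsetI)
    fix z assume z: "z \<in> stable_zero_points F"
    then have "z \<in> cbox 0 1" "F z = 0" by (auto simp: stable_zero_points_def zero_points_def)
    then obtain x where x: "x \<in> {0..1}" "z = x *\<^sub>R 1" using diagonal by blast
    moreover have "diag_drift \<alpha> \<beta> q \<theta> x *\<^sub>R (1 :: real ^ 'n) = 0"
      using z x(2) F_diag[of x] by (simp add: stable_zero_points_def zero_points_def)
    ultimately show "z \<in> (\<lambda>x. x *\<^sub>R 1) `
        {x \<in> {0..1}. diag_drift \<alpha> \<beta> q \<theta> x = 0 \<and> diag_slope \<alpha> \<beta> \<theta> x \<le> 0}"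
      using z stable[of x] by (auto simp: stable_zero_points_def)
  next
    fix z :: "real ^ 'n" assume "z \<in> (\<lambda>x. x *\<^sub>R 1) `
        {x \<in> {0..1}. diag_drift \<alpha> \<beta> q \<theta> x = 0 \<and> diag_slope \<alpha> \<beta> \<theta> x \<le> 0}"
    then obtain x where "x \<in> {0..1}" "diag_drift \<alpha> \<beta> q \<theta> x = 0" "diag_slope \<alpha> \<beta> \<theta> x \<le> 0" "z = x *\<^sub>R 1"
      by blast
    then show "z \<in> stable_zero_points F"
      using stable[of x] F_diag[of x]
      by (auto simp: stable_zero_points_def zero_points_def mem_box_cart)
  qed
qed

text \<open>Near \<open>u\<close> the slope exceeds \<kappa> by continuity, and the mean value
  theorem passes to chords. The rate is reduced by \<alpha> because the mean contributes that part
  separately when the components are summed.\<close>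

lemma diag_drift_expansion:
  assumes "0 < diag_slope \<alpha> \<beta> \<theta> u" "0 < 1 - \<alpha> - \<beta>"
  obtains \<epsilon> \<kappa> where "0 < \<epsilon>" "0 < \<kappa>" "\<kappa> \<le> 1"
    "\<And>x y. \<bar>x - u\<bar> \<le> \<epsilon> \<Longrightarrow> \<bar>y - u\<bar> \<le> \<epsilon> \<Longrightarrow> x \<le> y \<Longrightarrow>
       (1 + \<kappa> - \<alpha>) * (y - x) \<le> (1 - \<alpha> - \<beta>) * (f_theta \<theta> y - f_theta \<theta> x)"
proof -
  \<comment> \<open>Half of the slope leaves a strict margin at \<open>u\<close>; the cap 1 is what
    \<open>cooperative_urn\<close> asks for.\<close>
  define \<kappa> where "\<kappa> = min 1 (diag_slope \<alpha> \<beta> \<theta> u / 2)"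
  have "isCont (diag_slope \<alpha> \<beta> \<theta>) u" unfolding diag_slope_def[abs_def] by (intro continuous_intros)
  moreover have "\<kappa> < diag_slope \<alpha> \<beta> \<theta> u" using assms(1) by (auto simp: \<kappa>_def)
  ultimately have "\<forall>\<^sub>F x in at u. \<kappa> < diag_slope \<alpha> \<beta> \<theta> x"
    by (intro order_tendstoD(1)) (auto simp: isCont_def)
  then obtain \<epsilon>' where e: "\<epsilon>' > 0" "\<And>x. x \<noteq> u \<Longrightarrow> \<bar>x - u\<bar> < \<epsilon>' \<Longrightarrow> \<kappa> < diag_slope \<alpha> \<beta> \<theta> x"
    unfolding eventually_at by (auto simp: dist_real_def)
  have slope: "\<kappa> < diag_slope \<alpha> \<beta> \<theta> x" if "\<bar>x - u\<bar> \<le> \<epsilon>' / 2" for x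
    using e that \<open>\<kappa> < diag_slope \<alpha> \<beta> \<theta> u\<close> by (cases "x = u") auto
  show ?thesis
  proof (rule that[of "\<epsilon>' / 2" \<kappa>])
    fix x y assume xy: "\<bar>x - u\<bar> \<le> \<epsilon>' / 2" "\<bar>y - u\<bar> \<le> \<epsilon>' / 2" "x \<le> y"
    show "(1 + \<kappa> - \<alpha>) * (y - x) \<le> (1 - \<alpha> - \<beta>) * (f_theta \<theta> y - f_theta \<theta> x)"
    proof (cases "x = y")
      case False
      then have "x < y" using xy by simp
      from MVT2[OF this f_theta_has_derivative] obtain w where w: "x < w" "w < y"
        "f_theta \<theta> y - f_theta \<theta> x = (y - x) * ((2 * \<theta> - 1) * (6 * w * (1 - w)))" by blast
      have "\<kappa> < diag_slope \<alpha> \<beta> \<theta> w" using w(1,2) xy by (intro slope) linarith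
      then have "(1 + \<kappa> - \<alpha>) * (y - x) \<le> ((1 - \<alpha> - \<beta>) * ((2 * \<theta> - 1) * (6 * w * (1 - w)))) * (y - x)"
        using \<open>x < y\<close> by (intro mult_right_mono) (auto simp: diag_slope_def)
      then show ?thesis unfolding w(3) by (simp add: mult_ac)
    qed simp
  qed (use e assms in \<open>auto simp: \<kappa>_def\<close>)
qed

section \<open>The reinforced system\<close>

lemma borel_measurable_vec:
  fixes g :: "'a \<Rightarrow> real ^ 'n::finite"
  assumes "\<And>h. (\<lambda>x. g x $ h) \<in> borel_measurable M"
  shows "g \<in> borel_measurable M"
proof -
  have "(\<lambda>x. g x \<bullet> b) \<in> borel_measurable M" if "b \<in> Basis" for b
  proof -
    obtain h where "b = axis h 1" using \<open>b \<in> Basis\<close> by (auto simp: Basis_vec_def)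
    then have "g x \<bullet> b = g x $ h" for x by (simp add: inner_axis)
    then show ?thesis by (simp only: assms)
  qed
  then show ?thesis unfolding borel_measurable_euclidean_space[of g] by blast
qed

lemma sum_indicator_fibres:
  fixes G :: "'b::finite \<Rightarrow> real"
  assumes "\<omega> \<in> S"
  shows "(\<Sum>i\<in>UNIV. G i * indicator {\<omega> \<in> S. X \<omega> = i} \<omega>) = G (X \<omega>)"
proof -
  have "G i * indicator {\<omega> \<in> S. X \<omega> = i} \<omega> = (if X \<omega> = i then G i else 0)" for i
    using assms by simp
  then show ?thesis by simp
qed

locale theta_system = reinforced_system M \<alpha> \<beta> q "f_theta \<theta>" r Z I
  for M :: "'a measure" and \<alpha> \<beta> q \<theta> :: real and r :: "nat \<Rightarrow> real"
    and Z I :: "nat \<Rightarrow> 'a \<Rightarrow> real ^ 'n::finite" +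
  assumes theta: "1 / 2 < \<theta>" "\<theta> < 1"
    and theta_le: "3 * \<theta> - 3 / 2 \<le> 1 / (1 - \<alpha> - \<beta>)"
begin

definition success :: "real ^ 'n \<Rightarrow> 'n \<Rightarrow> real" where
  "success z h = \<alpha> * mean z + \<beta> * q + (1 - \<alpha> - \<beta>) * f_theta \<theta> (z $ h)"

lemma gamma_pos: "0 < 1 - \<alpha> - \<beta>" using alpha_beta by simp

lemma gain_pos: "0 < (1 - \<alpha> - \<beta>) * (2 * \<theta> - 1)" using gamma_pos theta by simp

lemma gain_le: "(1 - \<alpha> - \<beta>) * (3 * \<theta> - 3 / 2) \<le> 1"
  using theta_le gamma_pos by (simp add: field_simps)

section \<open>Adaptedness of the chain and bounds on the success probabilities\<close>

lemma gen_subset_Pow: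
  "{(\<lambda>\<omega>. Z 0 \<omega> $ h) -` A \<inter> space M | h A. A \<in> sets borel} \<union>
   {(\<lambda>\<omega>. I k \<omega> $ h) -` A \<inter> space M | k h A. 1 \<le> k \<and> k \<le> n \<and> A \<in> sets borel} \<subseteq> Pow (space M)"
  by auto

lemma space_history [simp]: "space (history M Z I n) = space M"
  unfolding history_def by (rule space_measure_of[OF gen_subset_Pow])

lemma sets_history:
  "sets (history M Z I n) = sigma_sets (space M)
     ({(\<lambda>\<omega>. Z 0 \<omega> $ h) -` A \<inter> space M | h A. A \<in> sets borel} \<union>
      {(\<lambda>\<omega>. I k \<omega> $ h) -` A \<inter> space M | k h A. 1 \<le> k \<and> k \<le> n \<and> A \<in> sets borel})"
  unfolding history_def by (rule sets_measure_of[OF gen_subset_Pow])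

lemma Z0_history: "(\<lambda>\<omega>. Z 0 \<omega> $ h) \<in> borel_measurable (history M Z I n)"
  by (rule measurableI) (auto simp: sets_history intro!: sigma_sets.Basic)

lemma I_history: "1 \<le> k \<Longrightarrow> k \<le> n \<Longrightarrow> (\<lambda>\<omega>. I k \<omega> $ h) \<in> borel_measurable (history M Z I n)"
  by (rule measurableI) (auto simp: sets_history intro!: sigma_sets.Basic)

lemma history_mono:
  assumes "m \<le> n"
  shows "sets (history M Z I m) \<subseteq> sets (history M Z I n)"
proof -
  have "k \<le> n" if "k \<le> m" for k using assms that by (rule order_trans[rotated])
  then have "{(\<lambda>\<omega>. I k \<omega> $ h) -` A \<inter> space M | k h A. 1 \<le> k \<and> k \<le> m \<and> A \<in> sets borel}
      \<subseteq> {(\<lambda>\<omega>. I k \<omega> $ h) -` A \<inter> space M | k h A. 1 \<le> k \<and> k \<le> n \<and> A \<in> sets borel}"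
    by blast
  then show ?thesis unfolding sets_history by (intro sigma_sets_mono' Un_mono subset_refl)
qed

lemma measurable_history_mono:
  fixes Y :: "'a \<Rightarrow> real"
  assumes "m \<le> n" "Y \<in> borel_measurable (history M Z I m)"
  shows "Y \<in> borel_measurable (history M Z I n)"
proof (rule measurable_from_subalg[OF _ assms(2)])
  show "subalgebra (history M Z I n) (history M Z I m)"
    using history_mono[OF assms(1)] by (simp add: subalgebra_def)
qed

lemma I_component_measurable [measurable]: "(\<lambda>\<omega>. I (Suc k) \<omega> $ h) \<in> borel_measurable M"
  using measurable_compose[OF I_measurable borel_measurable_nth] .

lemma subalgebra_history: "subalgebra M (history M Z I n)"
  unfolding subalgebra_def
proof
  have "(\<lambda>\<omega>. Z 0 \<omega> $ h) -` A \<inter> space M \<in> sets M" if "A \<in> sets borel" for h A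
    using measurable_sets[OF measurable_compose[OF Z0_measurable borel_measurable_nth] that] .
  moreover have "(\<lambda>\<omega>. I k \<omega> $ h) -` A \<inter> space M \<in> sets M" if "A \<in> sets borel" "1 \<le> k" for h A k
    using measurable_sets[OF I_component_measurable[of "k - 1"] that(1)] that(2) by simp
  ultimately show "sets (history M Z I n) \<subseteq> sets M"
    unfolding sets_history by (intro sets.sigma_sets_subset) auto
qed simp

lemma measurable_if_history:
  fixes Y :: "'a \<Rightarrow> real"
  shows "Y \<in> borel_measurable (history M Z I n) \<Longrightarrow> Y \<in> borel_measurable M"
  by (rule measurable_from_subalg[OF subalgebra_history])

text \<open>The history is generated by the initial state and the draws alone; later states are
  recovered from them through the recursion.\<close>

lemma Z_component_history: "(\<lambda>\<omega>. Z n \<omega> $ h) \<in> borel_measurable (history M Z I n)"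
proof (induction n arbitrary: h)
  case (Suc n)
  have "(\<lambda>\<omega>. (1 - r n) * Z n \<omega> $ h + r n * I (Suc n) \<omega> $ h) \<in> borel_measurable (history M Z I (Suc n))"
    by (intro borel_measurable_add borel_measurable_times borel_measurable_const
        measurable_history_mono[OF le_SucI[OF order_refl] Suc] I_history) auto
  moreover have "(\<lambda>\<omega>. Z (Suc n) \<omega> $ h) \<in> borel_measurable (history M Z I (Suc n)) \<longleftrightarrow>
      (\<lambda>\<omega>. (1 - r n) * Z n \<omega> $ h + r n * I (Suc n) \<omega> $ h) \<in> borel_measurable (history M Z I (Suc n))"
    by (rule measurable_cong) (unfold space_history, rule Z_Suc)
  ultimately show ?case by blast
qed (rule Z0_history)

lemma Z_history: "Z n \<in> borel_measurable (history M Z I n)"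
  by (rule borel_measurable_vec[OF Z_component_history])

lemma Z_measurable [measurable]: "Z n \<in> borel_measurable M"
  by (rule measurable_from_subalg[OF subalgebra_history Z_history])

lemma Z_Suc_urn_step:
  assumes "\<omega> \<in> space M"
  shows "Z (Suc n) \<omega> = urn_step (r n) (Z n \<omega>) (\<lambda>h. I (Suc n) \<omega> $ h = 1)"
  using I_range[OF assms, of n] by (auto simp: vec_eq_iff urn_step_def Z_Suc[OF assms])

lemma Z_in_cube: "\<omega> \<in> space M \<Longrightarrow> Z n \<omega> \<in> cbox 0 1"
proof (induction n)
  case 0
  then show ?case using Z0_range by (auto simp: mem_box_cart)
next
  case (Suc n)
  then show ?case by (simp add: Z_Suc_urn_step urn_step_in_cube[OF _ r_range])
qed

lemma mean_in_unit:
  fixes z :: "real ^ 'n"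
  assumes "z \<in> cbox 0 1"
  shows "mean z \<in> {0..1}"
proof -
  have z: "0 \<le> z $ h" "z $ h \<le> 1" for h using assms by (auto simp: mem_box_cart)
  have "(\<Sum>h\<in>UNIV. z $ h) \<le> (\<Sum>h\<in>(UNIV :: 'n set). 1)" using z(2) by (intro sum_mono)
  moreover have "0 \<le> (\<Sum>h\<in>UNIV. z $ h)" using z(1) by (intro sum_nonneg)
  ultimately show ?thesis by (simp add: mean_def divide_le_eq)
qed

lemma f_theta_bounds:
  assumes "x \<in> {0..1}"
  shows "f_theta \<theta> x \<in> {1 - \<theta>..\<theta>}"
proof -
  have mono: "mono_on {0..1} (f_theta \<theta>)"
    using f_theta_strict_mono[OF theta(1)] by (rule strict_mono_on_imp_mono_on)
  have "f_theta \<theta> 0 \<le> f_theta \<theta> x" "f_theta \<theta> x \<le> f_theta \<theta> 1"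
    using assms by (auto intro!: mono_onD[OF mono])
  then show ?thesis by (simp add: f_theta_def)
qed

text \<open>\<open>f_theta\<close> lies between 1 - \<theta> and \<theta>, so \<theta> < 1 keeps a
  fixed distance from both 0 and 1; this distance serves as the constant \<open>c\<close> of
  \<open>stay_prob_uniformly_small\<close>.\<close>

lemma success_bounds:
  assumes "z \<in> cbox 0 1"
  shows "success z h \<in> {(1 - \<alpha> - \<beta>) * (1 - \<theta>)..1 - (1 - \<alpha> - \<beta>) * (1 - \<theta>)}"
proof -
  have m: "0 \<le> mean z" "mean z \<le> 1" using mean_in_unit[OF assms] by auto
  have "z $ h \<in> {0..1}" using assms by (simp add: mem_box_cart)
  from f_theta_bounds[OF this] have f: "1 - \<theta> \<le> f_theta \<theta> (z $ h)" "f_theta \<theta> (z $ h) \<le> \<theta>" by auto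
  have "(1 - \<alpha> - \<beta>) * (1 - \<theta>) \<le> (1 - \<alpha> - \<beta>) * f_theta \<theta> (z $ h)"
       "(1 - \<alpha> - \<beta>) * f_theta \<theta> (z $ h) \<le> (1 - \<alpha> - \<beta>) * \<theta>"
    using f gamma_pos by (auto intro!: mult_left_mono)
  moreover have "0 \<le> \<alpha> * mean z" "\<alpha> * mean z \<le> \<alpha>" "0 \<le> \<beta> * q" "\<beta> * q \<le> \<beta>"
    using m alpha beta q by (auto intro!: mult_nonneg_nonneg mult_left_le)
  ultimately show ?thesis by (simp add: success_def algebra_simps)
qed

lemma success_unit:
  assumes "z \<in> cbox 0 1"
  shows "success z h \<in> {0..1}"
proof -
  have "0 \<le> (1 - \<alpha> - \<beta>) * (1 - \<theta>)" using gamma_pos theta by simp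
  then show ?thesis using success_bounds[OF assms, of h] by auto
qed

lemma success_mono:
  assumes "z \<in> cbox 0 1" "z' \<in> cbox 0 1" "\<And>h. z $ h \<le> z' $ h"
  shows "success z h \<le> success z' h"
proof -
  have "mean z \<le> mean z'"
    unfolding mean_def using assms(3) by (intro divide_right_mono sum_mono) auto
  moreover have "f_theta \<theta> (z $ h) \<le> f_theta \<theta> (z' $ h)"
    using strict_mono_on_imp_mono_on[OF f_theta_strict_mono[OF theta(1)]] assms
    by (auto simp: mem_box_cart intro: mono_onD)
  ultimately have "\<alpha> * mean z \<le> \<alpha> * mean z'"
      "(1 - \<alpha> - \<beta>) * f_theta \<theta> (z $ h) \<le> (1 - \<alpha> - \<beta>) * f_theta \<theta> (z' $ h)"
    using alpha(1) gamma_pos by (intro mult_left_mono; simp)+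
  then show ?thesis unfolding success_def by linarith
qed

lemma continuous_success: "continuous_on UNIV (\<lambda>z. success z h)"
  unfolding success_def mean_def f_theta_def by (intro continuous_intros) auto

lemma success_measurable: "(\<lambda>z. success z h) \<in> borel_measurable borel"
  by (rule borel_measurable_continuous_onI[OF continuous_success])

lemma urn_step_measurable: "(\<lambda>z :: real ^ 'n. urn_step \<rho> z i) \<in> borel_measurable borel"
  unfolding urn_step_def
  by (intro borel_measurable_continuous_onI continuous_intros)

lemma bounded_integrable:
  fixes g :: "'a \<Rightarrow> real"
  assumes "g \<in> borel_measurable M" "\<And>\<omega>. \<omega> \<in> space M \<Longrightarrow> \<bar>g \<omega>\<bar> \<le> B"
  shows "integrable M g"
  using assms by (intro integrable_const_bound[where B = B]) auto

lemma success_history: "(\<lambda>\<omega>. success (Z n \<omega>) h) \<in> borel_measurable (history M Z I n)"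
  by (rule measurable_compose[OF Z_history success_measurable])

lemma success_Z_measurable: "(\<lambda>\<omega>. success (Z n \<omega>) h) \<in> borel_measurable M"
  by (rule measurable_if_history[OF success_history])

lemma success_prod_measurable [measurable]:
  "(\<lambda>\<omega>. \<Prod>h\<in>UNIV. if i h then success (Z n \<omega>) h else 1 - success (Z n \<omega>) h) \<in> borel_measurable M"
proof (rule borel_measurable_prod)
  fix h
  show "(\<lambda>\<omega>. if i h then success (Z n \<omega>) h else 1 - success (Z n \<omega>) h) \<in> borel_measurable M"
  proof (cases "i h")
    case True
    show ?thesis unfolding if_P[OF True] by (rule success_Z_measurable)
  next
    case False
    show ?thesis
      unfolding if_not_P[OF False] by (intro borel_measurable_diff borel_measurable_const success_Z_measurable)
  qed
qed

section \<open>The conditional law of a draw, integrated against the past\<close>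

lemma cond_prob_component:
  "AE \<omega> in M. real_cond_exp M (history M Z I n)
       (indicator ((\<lambda>\<omega>. I (Suc n) \<omega> $ h) -` {of_bool b} \<inter> space M)) \<omega>
     = (if b then success (Z n \<omega>) h else 1 - success (Z n \<omega>) h)"
proof -
  interpret S: finite_measure_subalgebra M "history M Z I n"
    by unfold_locales (rule subalgebra_history)
  let ?A = "{\<omega> \<in> space M. I (Suc n) \<omega> $ h = 1}"
  have A: "?A \<in> sets M" by measurable
  have P: "AE \<omega> in M. real_cond_exp M (history M Z I n) (indicator ?A) \<omega> = success (Z n \<omega>) h"
    using I_cond_prob[of n h] by (simp add: success_def)
  show ?thesis
  proof (cases b)
    case True
    have "(\<lambda>\<omega>. I (Suc n) \<omega> $ h) -` {of_bool b} \<inter> space M = ?A" using True by auto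
    then show ?thesis using P True by simp
  next
    case False
    let ?B = "(\<lambda>\<omega>. I (Suc n) \<omega> $ h) -` {of_bool b} \<inter> space M"
    have B: "?B \<in> sets M" by measurable
    \<comment> \<open>A draw is 0 or 1, so the failure event is the complement of the success event
      and linearity gives its conditional probability.\<close>
    have "AE \<omega> in M. real_cond_exp M (history M Z I n) (indicator ?B) \<omega>
        = real_cond_exp M (history M Z I n) (\<lambda>\<omega>. 1 - indicator ?A \<omega>) \<omega>"
      by (rule S.real_cond_exp_cong)
         (use A B I_range[of _ n h] False in \<open>auto simp: indicator_def\<close>)
    moreover have "AE \<omega> in M. real_cond_exp M (history M Z I n) (\<lambda>\<omega>. 1 - indicator ?A \<omega>) \<omega>
        = real_cond_exp M (history M Z I n) (\<lambda>_. 1) \<omega> - real_cond_exp M (history M Z I n) (indicator ?A) \<omega>"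
      using A by (intro S.real_cond_exp_diff) (auto simp: integrable_indicator_iff less_top[symmetric])
    moreover have "AE \<omega> in M. real_cond_exp M (history M Z I n) (\<lambda>_. 1 :: real) \<omega> = 1"
      by (rule S.real_cond_exp_F_meas) auto
    ultimately show ?thesis using P
      by eventually_elim (simp add: False)
  qed
qed

text \<open>An outcome is an intersection of one event per component, so conditional independence
  for the full index set and singletons gives the product of the factors in
  \<open>cond_prob_component\<close>. Testing against a bounded \<open>Y\<close> known at time n
  turns this into an identity of integrals.\<close>

lemma integral_outcome:
  fixes i :: "'n \<Rightarrow> bool"
  assumes Y: "Y \<in> borel_measurable (history M Z I n)" "\<And>\<omega>. \<omega> \<in> space M \<Longrightarrow> \<bar>Y \<omega>\<bar> \<le> B"
  shows "(\<integral>\<omega>. Y \<omega> * indicator {\<omega> \<in> space M. (\<lambda>h. I (Suc n) \<omega> $ h = 1) = i} \<omega> \<partial>M)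
    = (\<integral>\<omega>. Y \<omega> * (\<Prod>h\<in>UNIV. if i h then success (Z n \<omega>) h else 1 - success (Z n \<omega>) h) \<partial>M)"
proof -
  interpret S: finite_measure_subalgebra M "history M Z I n"
    by unfold_locales (rule subalgebra_history)
  let ?X = "\<lambda>h \<omega>. I (Suc n) \<omega> $ h"
  let ?E = "\<Inter>h\<in>UNIV. ?X h -` {of_bool (i h)} \<inter> space M"
  have E: "{\<omega> \<in> space M. (\<lambda>h. I (Suc n) \<omega> $ h = 1) = i} = ?E"
  proof -
    have "(?X h \<omega> = 1) = i h \<longleftrightarrow> ?X h \<omega> = of_bool (i h)" if "\<omega> \<in> space M" for h \<omega>
      using I_range[OF that, of n h] by (cases "i h") auto
    then show ?thesis unfolding fun_eq_iff by blast
  qed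
  have E_sets: "?E \<in> sets M"
    by (intro sets.finite_INT) auto
  have Y_M: "Y \<in> borel_measurable M" by (rule measurable_if_history[OF Y(1)])
  have "AE \<omega> in M. real_cond_exp M (history M Z I n) (indicator ?E) \<omega>
      = (\<Prod>h\<in>UNIV. real_cond_exp M (history M Z I n) (indicator (?X h -` {of_bool (i h)} \<inter> space M)) \<omega>)"
    using I_cond_indep[of n, unfolded cond_indep_vars_def, THEN conjunct2, rule_format,
        of UNIV "\<lambda>h. {of_bool (i h)}"] by auto
  moreover have "AE \<omega> in M. \<forall>h. real_cond_exp M (history M Z I n)
       (indicator (?X h -` {of_bool (i h)} \<inter> space M)) \<omega>
     = (if i h then success (Z n \<omega>) h else 1 - success (Z n \<omega>) h)"
    using cond_prob_component by (simp add: AE_all_countable)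
  ultimately have ae: "AE \<omega> in M. Y \<omega> * real_cond_exp M (history M Z I n) (indicator ?E) \<omega>
      = Y \<omega> * (\<Prod>h\<in>UNIV. if i h then success (Z n \<omega>) h else 1 - success (Z n \<omega>) h)"
    by eventually_elim simp
  have "(\<integral>\<omega>. Y \<omega> * indicator ?E \<omega> \<partial>M)
      = (\<integral>\<omega>. Y \<omega> * real_cond_exp M (history M Z I n) (indicator ?E) \<omega> \<partial>M)"
  proof (rule S.real_cond_exp_intg(2)[symmetric])
    have "\<bar>Y \<omega> * indicator ?E \<omega>\<bar> \<le> B" if "\<omega> \<in> space M" for \<omega>
      using Y(2)[OF that] by (auto simp: indicator_def)
    then show "integrable M (\<lambda>\<omega>. Y \<omega> * indicator ?E \<omega>)"
      by (intro bounded_integrable[where B = B] borel_measurable_times Y_M borel_measurable_indicator E_sets)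
  qed (use Y(1) E_sets in auto)
  also have "\<dots> = (\<integral>\<omega>. Y \<omega> * (\<Prod>h\<in>UNIV. if i h then success (Z n \<omega>) h else 1 - success (Z n \<omega>) h) \<partial>M)"
  proof (intro integral_cong_AE borel_measurable_times Y_M borel_measurable_cond_exp2 ae)
    show "(\<lambda>\<omega>. \<Prod>h\<in>UNIV. if i h then success (Z n \<omega>) h else 1 - success (Z n \<omega>) h) \<in> borel_measurable M"
      by (rule success_prod_measurable)
  qed
  finally show ?thesis unfolding E .
qed

text \<open>The Markov property in integrated form: the integrand is split over the finitely many
  outcomes of the next draw, and on each of them the new state is a function of the old one.\<close>

lemma integral_next_step:
  fixes g :: "real ^ 'n \<Rightarrow> real"
  assumes Y: "Y \<in> borel_measurable (history M Z I n)" "\<And>\<omega>. \<omega> \<in> space M \<Longrightarrow> \<bar>Y \<omega>\<bar> \<le> 1"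
    and g[measurable]: "g \<in> borel_measurable borel" and g_le: "\<And>z. z \<in> cbox 0 1 \<Longrightarrow> \<bar>g z\<bar> \<le> 1"
  shows "(\<integral>\<omega>. Y \<omega> * g (Z (Suc n) \<omega>) \<partial>M)
    = (\<integral>\<omega>. Y \<omega> * bernoulli_mean (success (Z n \<omega>)) (\<lambda>i. g (urn_step (r n) (Z n \<omega>) i)) \<partial>M)"
proof -
  note [measurable] = measurable_if_history[OF Y(1)]
  have sets [measurable]: "{\<omega> \<in> space M. (\<lambda>h. I (Suc n) \<omega> $ h = 1) = i} \<in> sets M" for i :: "'n \<Rightarrow> bool"
  proof -
    have "(\<lambda>\<omega>. I (Suc n) \<omega> $ h) -` (if i h then {1} else - {1}) \<inter> space M \<in> sets M" for h
      by (rule measurable_sets[OF I_component_measurable]) auto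
    then have "(\<Inter>h\<in>UNIV. (\<lambda>\<omega>. I (Suc n) \<omega> $ h) -` (if i h then {1} else - {1}) \<inter> space M) \<in> sets M"
      by (intro sets.finite_INT) auto
    moreover have "{\<omega> \<in> space M. (\<lambda>h. I (Suc n) \<omega> $ h = 1) = i}
        = (\<Inter>h\<in>UNIV. (\<lambda>\<omega>. I (Suc n) \<omega> $ h) -` (if i h then {1} else - {1}) \<inter> space M)"
      by (auto simp: fun_eq_iff split: if_splits)
    ultimately show ?thesis by simp
  qed
  define Yg where "Yg i \<omega> = Y \<omega> * g (urn_step (r n) (Z n \<omega>) i)" for i \<omega>
  have Yg: "Yg i \<in> borel_measurable (history M Z I n)" for i
    unfolding Yg_def
    by (intro borel_measurable_times Y measurable_compose[OF measurable_compose[OF Z_history urn_step_measurable] g])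
  note [measurable] = measurable_if_history[OF Yg]
  have Yg_le: "\<bar>Yg i \<omega>\<bar> \<le> 1" if "\<omega> \<in> space M" for i \<omega>
    using mult_mono[OF Y(2)[OF that] g_le[OF urn_step_in_cube[OF Z_in_cube[OF that] r_range]]]
    by (simp add: Yg_def abs_mult)
  have "(\<integral>\<omega>. Y \<omega> * g (Z (Suc n) \<omega>) \<partial>M)
      = (\<integral>\<omega>. (\<Sum>i\<in>UNIV. Yg i \<omega> * indicator {\<omega> \<in> space M. (\<lambda>h. I (Suc n) \<omega> $ h = 1) = i} \<omega>) \<partial>M)"
  proof (rule Bochner_Integration.integral_cong[OF refl])
    fix \<omega> assume \<omega>: "\<omega> \<in> space M"
    show "Y \<omega> * g (Z (Suc n) \<omega>)
        = (\<Sum>i\<in>UNIV. Yg i \<omega> * indicator {\<omega> \<in> space M. (\<lambda>h. I (Suc n) \<omega> $ h = 1) = i} \<omega>)"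
      unfolding sum_indicator_fibres[OF \<omega>] by (simp add: Yg_def Z_Suc_urn_step[OF \<omega>])
  qed
  also have "\<dots> = (\<Sum>i\<in>UNIV. \<integral>\<omega>. Yg i \<omega> * indicator {\<omega> \<in> space M. (\<lambda>h. I (Suc n) \<omega> $ h = 1) = i} \<omega> \<partial>M)"
    using Yg_le by (intro Bochner_Integration.integral_sum bounded_integrable[where B = 1])
       (auto simp: indicator_def)
  also have "\<dots> = (\<Sum>i\<in>UNIV. \<integral>\<omega>. Yg i \<omega> *
      (\<Prod>h\<in>UNIV. if i h then success (Z n \<omega>) h else 1 - success (Z n \<omega>) h) \<partial>M)"
    using Yg_le by (intro sum.cong refl integral_outcome[OF Yg])
  also have "\<dots> = (\<integral>\<omega>. (\<Sum>i\<in>UNIV. Yg i \<omega> *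
      (\<Prod>h\<in>UNIV. if i h then success (Z n \<omega>) h else 1 - success (Z n \<omega>) h)) \<partial>M)"
  proof (rule Bochner_Integration.integral_sum[symmetric], rule bounded_integrable[where B = 1])
    fix i :: "'n \<Rightarrow> bool" and \<omega> assume \<omega>: "\<omega> \<in> space M"
    let ?p = "\<Prod>h\<in>UNIV. if i h then success (Z n \<omega>) h else 1 - success (Z n \<omega>) h"
    have "0 \<le> success (Z n \<omega>) h" "success (Z n \<omega>) h \<le> 1" for h
      using success_unit[OF Z_in_cube[OF \<omega>]] by auto
    then have "0 \<le> ?p" "?p \<le> 1" by (auto intro!: prod_nonneg prod_le_1)
    then have "\<bar>Yg i \<omega>\<bar> * \<bar>?p\<bar> \<le> 1 * 1" using Yg_le[OF \<omega>] by (intro mult_mono) auto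
    then show "\<bar>Yg i \<omega> * ?p\<bar> \<le> 1" by (simp add: abs_mult)
  qed measurable
  also have "\<dots> = (\<integral>\<omega>. Y \<omega> * bernoulli_mean (success (Z n \<omega>)) (\<lambda>i. g (urn_step (r n) (Z n \<omega>) i)) \<partial>M)"
    by (simp add: bernoulli_mean_def Yg_def sum_distrib_left mult_ac)
  finally show ?thesis .
qed

lemma stay_prob_measurable:
  assumes U: "U \<in> sets borel"
  shows "stay_prob success r U k n \<in> borel_measurable borel"
proof (induction k arbitrary: n)
  case 0
  then show ?case using borel_measurable_indicator[OF U] by simp
next
  case (Suc k)
  have weight: "(\<lambda>z. if b then success z h else 1 - success z h) \<in> borel_measurable borel" for b h
  proof (cases b)
    case True
    show ?thesis unfolding if_P[OF True] by (rule success_measurable)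
  next
    case False
    show ?thesis unfolding if_not_P[OF False]
      by (intro borel_measurable_diff borel_measurable_const success_measurable)
  qed
  show ?case
    unfolding stay_prob.simps bernoulli_mean_def
    by (intro borel_measurable_times borel_measurable_sum borel_measurable_prod
        borel_measurable_indicator U weight measurable_compose[OF urn_step_measurable Suc])
qed

lemma Z_event:
  assumes "U \<in> sets borel" "finite J" "\<And>j. j \<in> J \<Longrightarrow> j \<le> n"
  shows "{\<omega> \<in> space M. \<forall>j\<in>J. Z j \<omega> \<in> U} \<in> sets (history M Z I n)"
proof -
  have "{\<omega> \<in> space (history M Z I n). Z j \<omega> \<in> U} \<in> sets (history M Z I n)" if "j \<in> J" for j
  proof -
    have "Z j -` U \<inter> space (history M Z I j) \<in> sets (history M Z I j)"
      using measurable_sets[OF Z_history assms(1)] .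
    then have "Z j -` U \<inter> space (history M Z I j) \<in> sets (history M Z I n)"
      using history_mono[OF assms(3)[OF that]] by blast
    moreover have "Z j -` U \<inter> space (history M Z I j) = {\<omega> \<in> space (history M Z I n). Z j \<omega> \<in> U}"
      unfolding space_history by blast
    ultimately show ?thesis by simp
  qed
  from sets.sets_Collect_finite_All[OF this assms(2)] show ?thesis unfolding space_history .
qed

text \<open>The indicator of \<open>U\<close> at time n is absorbed into the test variable, which is
  why \<open>Y\<close> is arbitrary: the new test variable is still known at time n, and the
  induction continues from time n + 1.\<close>

lemma integral_stay_prob:
  assumes coop: "cooperative_urn success r U \<kappa>" and U: "U \<in> sets borel"
    and Y: "Y \<in> borel_measurable (history M Z I n)" "\<And>\<omega>. \<omega> \<in> space M \<Longrightarrow> \<bar>Y \<omega>\<bar> \<le> 1"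
  shows "(\<integral>\<omega>. Y \<omega> * stay_prob success r U k n (Z n \<omega>) \<partial>M)
    = (\<integral>\<omega>. Y \<omega> * indicator {\<omega> \<in> space M. \<forall>j\<in>{n..n + k}. Z j \<omega> \<in> U} \<omega> \<partial>M)"
  using Y
proof (induction k arbitrary: n Y)
  case 0
  show ?case
    by (rule Bochner_Integration.integral_cong) (simp_all add: indicator_def)
next
  case (Suc k)
  interpret cooperative_urn success r U \<kappa> by (rule coop)
  define Y' where "Y' \<omega> = Y \<omega> * indicator U (Z n \<omega>)" for \<omega>
  have Y': "Y' \<in> borel_measurable (history M Z I n)"
    unfolding Y'_def
    by (intro borel_measurable_times Suc.prems(1)
        measurable_compose[OF Z_history borel_measurable_indicator[OF U]])
  have Y'_le: "\<bar>Y' \<omega>\<bar> \<le> 1" if "\<omega> \<in> space M" for \<omega>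
    using Suc.prems(2)[OF that] by (simp add: Y'_def indicator_def)
  have g_le: "\<bar>stay_prob success r U k (Suc n) z\<bar> \<le> 1" if "z \<in> cbox 0 1" for z
    using stay_prob_bounds[OF that, of k "Suc n"] by simp
  have "(\<integral>\<omega>. Y \<omega> * stay_prob success r U (Suc k) n (Z n \<omega>) \<partial>M)
      = (\<integral>\<omega>. Y' \<omega> * bernoulli_mean (success (Z n \<omega>))
           (\<lambda>i. stay_prob success r U k (Suc n) (urn_step (r n) (Z n \<omega>) i)) \<partial>M)"
    by (simp only: Y'_def stay_prob.simps mult.assoc)
  also have "\<dots> = (\<integral>\<omega>. Y' \<omega> * stay_prob success r U k (Suc n) (Z (Suc n) \<omega>) \<partial>M)"
    by (rule integral_next_step[OF Y' Y'_le stay_prob_measurable[OF U] g_le, symmetric])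
  also have "\<dots> = (\<integral>\<omega>. Y' \<omega> * indicator {\<omega> \<in> space M. \<forall>j\<in>{Suc n..Suc n + k}. Z j \<omega> \<in> U} \<omega> \<partial>M)"
    by (rule Suc.IH[OF measurable_history_mono[OF le_SucI[OF order_refl] Y'] Y'_le])
  also have "\<dots> = (\<integral>\<omega>. Y \<omega> * indicator {\<omega> \<in> space M. \<forall>j\<in>{n..n + Suc k}. Z j \<omega> \<in> U} \<omega> \<partial>M)"
  proof (rule Bochner_Integration.integral_cong[OF refl])
    fix \<omega> assume "\<omega> \<in> space M"
    have "{n..n + Suc k} = insert n {Suc n..Suc n + k}" by auto
    then show "Y' \<omega> * indicator {\<omega> \<in> space M. \<forall>j\<in>{Suc n..Suc n + k}. Z j \<omega> \<in> U} \<omega>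
        = Y \<omega> * indicator {\<omega> \<in> space M. \<forall>j\<in>{n..n + Suc k}. Z j \<omega> \<in> U} \<omega>"
      by (simp add: Y'_def indicator_def)
  qed
  finally show ?case .
qed

section \<open>Step sizes and escape from the unstable zeros\<close>

lemma r_bound: obtains C where "\<And>n. r n \<le> C / real (Suc n)"
proof -
  have "Bseq (\<lambda>n. real n * r n)" using r_lim convergentI convergent_imp_Bseq by blast
  then obtain K where K: "\<And>n. norm (real n * r n) \<le> K" by (auto simp: Bseq_def)
  have "r n \<le> (K + 1) / real (Suc n)" for n
  proof -
    have "real n * r n \<le> K" "r n \<le> 1" using K[of n] r_range[of n] by auto
    then have "real n * r n + r n \<le> K + 1" by linarith
    then show ?thesis by (simp add: field_simps)
  qed
  then show ?thesis by (rule that)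
qed

lemma r_nonneg: "0 \<le> r n" using r_range[of n] by simp

lemma r_tendsto_0: "r \<longlonglongrightarrow> 0"
proof -
  obtain C where C: "\<And>n. r n \<le> C / real (Suc n)" by (rule r_bound) (rule that; blast)
  have "(\<lambda>n. C / real (Suc n)) \<longlonglongrightarrow> 0" using LIMSEQ_Suc[OF lim_const_over_n[of C]] by simp
  then show ?thesis
    by (rule tendsto_sandwich[OF always_eventually always_eventually tendsto_const, rotated 2])
       (use C r_nonneg in auto)
qed

lemma not_summable_r: "\<not> summable r"
proof
  assume r: "summable r"
  have "\<forall>\<^sub>F n in sequentially. 1 / 2 < real n * r n"
    using order_tendstoD(1)[OF r_lim, of "1 / 2"] by simp
  then have "\<forall>\<^sub>F n in sequentially. norm (inverse (real n)) \<le> 2 * r n"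
  proof eventually_elim
    case (elim n)
    then have "0 < n" by (cases n) auto
    then show ?case using elim by (simp add: field_simps)
  qed
  from summable_comparison_test_ev[OF this summable_mult[OF r]]
  show False using not_summable_harmonic[where 'a = real] by simp
qed

text \<open>Having stayed up to time n, staying for \<open>k\<close> further steps costs a factor 1
  - \<delta>. Letting n tend to infinity, the probability p of staying forever satisfies p \<le> (1
  - \<delta>) p, hence p = 0.\<close>

lemma AE_leaves_expanding_set:
  assumes coop: "cooperative_urn success r U \<kappa>" and U: "U \<in> sets borel"
  shows "AE \<omega> in M. \<not> (\<forall>j\<ge>n0. Z j \<omega> \<in> U)"
proof -
  interpret cooperative_urn success r U \<kappa> by (rule coop)
  define B where "B n = {\<omega> \<in> space M. \<forall>j\<in>{n0..n}. Z j \<omega> \<in> U}" for n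
  define Binf where "Binf = {\<omega> \<in> space M. \<forall>j\<ge>n0. Z j \<omega> \<in> U}"
  have B_hist: "B n \<in> sets (history M Z I n)" for n
    unfolding B_def by (rule Z_event[OF U]) auto
  have B_sets: "B n \<in> sets M" for n
    using B_hist subalgebra_history by (auto simp: subalgebra_def)
  have Binf: "(\<Inter>n. B n) = Binf" unfolding B_def Binf_def by auto (meson atLeastAtMost_iff order_refl)
  have Binf_sets: "Binf \<in> sets M" unfolding Binf[symmetric] using B_sets by blast
  have "(\<lambda>n. prob (B n)) \<longlonglongrightarrow> prob (\<Inter>n. B n)"
    using B_sets by (intro finite_Lim_measure_decseq) (auto simp: B_def decseq_def)
  then have lim: "(\<lambda>n. prob (B n)) \<longlonglongrightarrow> prob Binf" unfolding Binf .
  have c: "0 < (1 - \<alpha> - \<beta>) * (1 - \<theta>)" using gamma_pos theta by simp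
  obtain \<delta> where \<delta>: "0 < \<delta>"
    "\<forall>\<^sub>F n in sequentially. \<exists>k. \<forall>z\<in>cbox 0 1. stay_prob success r U k n z \<le> 1 - \<delta>"
    using stay_prob_uniformly_small[OF r_lim not_summable_r c success_bounds] by blast
  have "\<forall>\<^sub>F n in sequentially. prob Binf \<le> (1 - \<delta>) * prob (B n)"
    using \<delta>(2) eventually_ge_at_top[of n0]
  proof eventually_elim
    case (elim n)
    then obtain k where k: "\<And>z. z \<in> cbox 0 1 \<Longrightarrow> stay_prob success r U k n z \<le> 1 - \<delta>" by blast
    have "prob Binf \<le> prob (B (n + k))"
      using B_sets by (intro finite_measure_mono) (auto simp: B_def Binf_def)
    also have "\<dots> = (\<integral>\<omega>. indicator (B (n + k)) \<omega> \<partial>M)" using B_sets by simp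
    also have "\<dots> = (\<integral>\<omega>. indicator (B n) \<omega> * indicator {\<omega> \<in> space M. \<forall>j\<in>{n..n + k}. Z j \<omega> \<in> U} \<omega> \<partial>M)"
    proof (rule Bochner_Integration.integral_cong[OF refl])
      fix \<omega> assume "\<omega> \<in> space M"
      have "{n0..n + k} = {n0..n} \<union> {n..n + k}" using elim(2) by auto
      then show "indicator (B (n + k)) \<omega>
          = indicator (B n) \<omega> * (indicator {\<omega> \<in> space M. \<forall>j\<in>{n..n + k}. Z j \<omega> \<in> U} \<omega> :: real)"
        by (auto simp: B_def indicator_def)
    qed
    also have "\<dots> = (\<integral>\<omega>. indicator (B n) \<omega> * stay_prob success r U k n (Z n \<omega>) \<partial>M)"
      by (rule integral_stay_prob[OF coop U borel_measurable_indicator[OF B_hist], symmetric]) simp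
    also have "\<dots> \<le> (\<integral>\<omega>. indicator (B n) \<omega> * (1 - \<delta>) \<partial>M)"
    proof (rule integral_mono)
      show "integrable M (\<lambda>\<omega>. indicator (B n) \<omega> * stay_prob success r U k n (Z n \<omega>))"
      proof (rule bounded_integrable[where B = 1])
        show "(\<lambda>\<omega>. indicator (B n) \<omega> * stay_prob success r U k n (Z n \<omega>)) \<in> borel_measurable M"
          by (intro borel_measurable_times borel_measurable_indicator B_sets
              measurable_compose[OF Z_measurable stay_prob_measurable[OF U]])
        fix \<omega> assume "\<omega> \<in> space M"
        from stay_prob_bounds[OF Z_in_cube[OF this], of k n n]
        show "\<bar>indicator (B n) \<omega> * stay_prob success r U k n (Z n \<omega>)\<bar> \<le> 1"
          by (simp add: indicator_def)
      qed
      show "integrable M (\<lambda>\<omega>. indicator (B n) \<omega> * (1 - \<delta>))"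
        using B_sets[of n] by (intro integrable_mult_left integrable_real_indicator)
          (auto simp: less_top[symmetric])
      show "indicator (B n) \<omega> * stay_prob success r U k n (Z n \<omega>) \<le> indicator (B n) \<omega> * (1 - \<delta>)"
        if "\<omega> \<in> space M" for \<omega>
        using k[OF Z_in_cube[OF that]] by (simp add: indicator_def)
    qed
    also have "\<dots> = (1 - \<delta>) * prob (B n)" using B_sets[of n] by simp
    finally show ?case .
  qed
  from tendsto_lowerbound[OF tendsto_mult_left[OF lim] this]
  have "prob Binf \<le> (1 - \<delta>) * prob Binf" by simp
  then have "\<delta> * prob Binf \<le> 0" by (simp add: algebra_simps)
  then have "prob Binf = 0" using \<delta>(1) by (simp add: mult_le_0_iff measure_le_0_iff)
  then have "AE \<omega> in M. \<omega> \<notin> Binf" using prob_eq_0[OF Binf_sets] by blast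
  then show ?thesis
    by (rule AE_mp, intro AE_I2 impI) (auto simp: Binf_def)
qed

text \<open>Convergence to \<open>u\<close> in all components would keep the chain in a closed box
  around the diagonal point from some time on. Each starting time is excluded almost surely, and
  there are countably many of them.\<close>

lemma AE_not_tendsto_unstable:
  assumes u: "0 < diag_slope \<alpha> \<beta> \<theta> u"
  shows "AE \<omega> in M. \<not> (\<forall>h. (\<lambda>n. Z n \<omega> $ h) \<longlonglongrightarrow> u)"
proof -
  obtain \<epsilon> \<kappa> where e: "0 < \<epsilon>" "0 < \<kappa>" "\<kappa> \<le> 1"
    and expand: "\<And>x y. \<bar>x - u\<bar> \<le> \<epsilon> \<Longrightarrow> \<bar>y - u\<bar> \<le> \<epsilon> \<Longrightarrow> x \<le> y \<Longrightarrow>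
       (1 + \<kappa> - \<alpha>) * (y - x) \<le> (1 - \<alpha> - \<beta>) * (f_theta \<theta> y - f_theta \<theta> x)"
    by (rule diag_drift_expansion[OF u gamma_pos]) (rule that; blast)
  define U where "U = {z :: real ^ 'n. \<forall>h. \<bar>z $ h - u\<bar> \<le> \<epsilon>}"
  have "closed U"
    unfolding U_def by (intro closed_Collect_all closed_Collect_le continuous_intros)
  then have U: "U \<in> sets borel" by (rule borel_closed)
  have coop: "cooperative_urn success r U \<kappa>"
  proof
    fix z z' :: "real ^ 'n"
    assume z: "z \<in> cbox 0 1 \<inter> U" "z' \<in> cbox 0 1 \<inter> U" and le: "\<And>h. z $ h \<le> z' $ h"
    define d where "d = (\<Sum>h\<in>UNIV. z' $ h - z $ h)"
    have mean_diff: "real CARD('n) * (\<alpha> * (mean z' - mean z)) = \<alpha> * d"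
      by (simp add: mean_def d_def sum_subtractf field_simps)
    \<comment> \<open>Each component contributes the rate \<open>1 + \<kappa> - \<alpha>\<close>,
      and the common mean supplies the missing \<alpha>.\<close>
    have "(1 + \<kappa> - \<alpha>) * d \<le> (\<Sum>h\<in>UNIV. (1 - \<alpha> - \<beta>) * (f_theta \<theta> (z' $ h) - f_theta \<theta> (z $ h)))"
      unfolding d_def sum_distrib_left using z le by (intro sum_mono expand) (auto simp: U_def)
    then have "(1 + \<kappa>) * d \<le> \<alpha> * d + (\<Sum>h\<in>UNIV. (1 - \<alpha> - \<beta>) * (f_theta \<theta> (z' $ h) - f_theta \<theta> (z $ h)))"
      by (simp add: algebra_simps)
    also have "\<dots> = (\<Sum>h\<in>UNIV. \<alpha> * (mean z' - mean z)
        + (1 - \<alpha> - \<beta>) * (f_theta \<theta> (z' $ h) - f_theta \<theta> (z $ h)))"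
      unfolding sum.distrib mean_diff[symmetric] by simp
    also have "\<dots> = (\<Sum>h\<in>UNIV. success z' h - success z h)"
      by (rule sum.cong[OF refl]) (simp add: success_def algebra_simps)
    finally show "(1 + \<kappa>) * (\<Sum>h\<in>UNIV. z' $ h - z $ h) \<le> (\<Sum>h\<in>UNIV. success z' h - success z h)"
      unfolding d_def .
  qed (use e success_unit success_mono r_range in auto)
  have "AE \<omega> in M. \<forall>n0. \<not> (\<forall>j\<ge>n0. Z j \<omega> \<in> U)"
    unfolding AE_all_countable using AE_leaves_expanding_set[OF coop U] by blast
  then show ?thesis
  proof eventually_elim
    case (elim \<omega>)
    show ?case
    proof
      assume "\<forall>h. (\<lambda>n. Z n \<omega> $ h) \<longlonglongrightarrow> u"
      then have "\<forall>\<^sub>F n in sequentially. \<bar>Z n \<omega> $ h - u\<bar> < \<epsilon>" for h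
        using tendstoD[of "\<lambda>n. Z n \<omega> $ h" u sequentially \<epsilon>] e(1) by (simp add: dist_real_def)
      then have "\<forall>\<^sub>F n in sequentially. \<forall>h. \<bar>Z n \<omega> $ h - u\<bar> < \<epsilon>"
        by (simp add: eventually_all_finite)
      then have "\<forall>\<^sub>F n in sequentially. Z n \<omega> \<in> U"
        by (rule eventually_mono) (auto simp: U_def intro: less_imp_le)
      then show False using elim by (auto simp: eventually_sequentially)
    qed
  qed
qed

section \<open>Martingale noise and the limit along a single path\<close>

definition noise :: "nat \<Rightarrow> 'n \<Rightarrow> 'a \<Rightarrow> real" where
  "noise n h \<omega> = I (Suc n) \<omega> $ h - success (Z n \<omega>) h"

lemma noise_history: "noise n h \<in> borel_measurable (history M Z I (Suc n))"
  unfolding noise_def[abs_def]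
  by (intro borel_measurable_diff I_history measurable_history_mono[OF le_SucI[OF order_refl] success_history]) auto

lemma noise_bounded: "\<omega> \<in> space M \<Longrightarrow> \<bar>noise n h \<omega>\<bar> \<le> 1"
  using I_range[of \<omega> n h] success_unit[OF Z_in_cube, of \<omega> n h] by (auto simp: noise_def)

text \<open>The martingale difference property in integrated form. With an earlier noise term as
  \<open>Y\<close> it is the orthogonality that \<open>AE_summable_orthogonal\<close>
  requires.\<close>

lemma integral_noise:
  assumes Y: "Y \<in> borel_measurable (history M Z I n)" "\<And>\<omega>. \<omega> \<in> space M \<Longrightarrow> \<bar>Y \<omega>\<bar> \<le> 1"
  shows "(\<integral>\<omega>. Y \<omega> * noise n h \<omega> \<partial>M) = 0"
proof -
  interpret S: finite_measure_subalgebra M "history M Z I n"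
    by unfold_locales (rule subalgebra_history)
  let ?A = "{\<omega> \<in> space M. I (Suc n) \<omega> $ h = 1}"
  have A: "?A \<in> sets M" by measurable
  have Y_M: "Y \<in> borel_measurable M" by (rule measurable_if_history[OF Y(1)])
  have int_A: "integrable M (\<lambda>\<omega>. Y \<omega> * indicator ?A \<omega>)"
  proof (rule bounded_integrable[where B = 1])
    show "(\<lambda>\<omega>. Y \<omega> * indicator ?A \<omega>) \<in> borel_measurable M"
      by (intro borel_measurable_times Y_M borel_measurable_indicator A)
    show "\<bar>Y \<omega> * indicator ?A \<omega>\<bar> \<le> 1" if "\<omega> \<in> space M" for \<omega>
      using Y(2)[OF that] by (simp add: indicator_def)
  qed
  have int_s: "integrable M (\<lambda>\<omega>. Y \<omega> * success (Z n \<omega>) h)"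
  proof (rule bounded_integrable[where B = 1])
    show "(\<lambda>\<omega>. Y \<omega> * success (Z n \<omega>) h) \<in> borel_measurable M"
      by (intro borel_measurable_times Y_M success_Z_measurable)
    fix \<omega> assume \<omega>: "\<omega> \<in> space M"
    have "\<bar>success (Z n \<omega>) h\<bar> \<le> 1" using success_unit[OF Z_in_cube[OF \<omega>], of n h] by auto
    from mult_mono[OF Y(2)[OF \<omega>] this] show "\<bar>Y \<omega> * success (Z n \<omega>) h\<bar> \<le> 1" by (simp add: abs_mult)
  qed
  have "(\<integral>\<omega>. Y \<omega> * noise n h \<omega> \<partial>M) = (\<integral>\<omega>. Y \<omega> * indicator ?A \<omega> - Y \<omega> * success (Z n \<omega>) h \<partial>M)"
  proof (rule Bochner_Integration.integral_cong[OF refl])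
    fix \<omega> assume \<omega>: "\<omega> \<in> space M"
    then have eq: "I (Suc n) \<omega> $ h = indicator ?A \<omega>" using I_range[OF \<omega>, of n h] by (auto simp: indicator_def)
    show "Y \<omega> * noise n h \<omega> = Y \<omega> * indicator ?A \<omega> - Y \<omega> * success (Z n \<omega>) h"
      unfolding noise_def right_diff_distrib by (subst eq) (rule refl)
  qed
  also have "\<dots> = (\<integral>\<omega>. Y \<omega> * indicator ?A \<omega> \<partial>M) - (\<integral>\<omega>. Y \<omega> * success (Z n \<omega>) h \<partial>M)"
    by (rule Bochner_Integration.integral_diff[OF int_A int_s])
  also have "(\<integral>\<omega>. Y \<omega> * indicator ?A \<omega> \<partial>M)
      = (\<integral>\<omega>. Y \<omega> * real_cond_exp M (history M Z I n) (indicator ?A) \<omega> \<partial>M)"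
    by (rule S.real_cond_exp_intg(2)[OF int_A Y(1) borel_measurable_indicator[OF A], symmetric])
  also have "\<dots> = (\<integral>\<omega>. Y \<omega> * success (Z n \<omega>) h \<partial>M)"
  proof (intro integral_cong_AE borel_measurable_times Y_M borel_measurable_cond_exp2 success_Z_measurable)
    show "AE \<omega> in M. Y \<omega> * real_cond_exp M (history M Z I n) (indicator ?A) \<omega> = Y \<omega> * success (Z n \<omega>) h"
      using I_cond_prob[of n h] by eventually_elim (simp add: success_def)
  qed
  finally show ?thesis by simp
qed

text \<open>The step sizes are left general because the series is needed both for the steps
  \<open>r n\<close> of the chain and for the steps 1 / (n + 1) of the empirical mean.\<close>

lemma AE_noise_summable:
  assumes a: "\<And>n. 0 \<le> a n" "\<And>n. a n \<le> C / real (Suc n)"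
  shows "AE \<omega> in M. \<forall>h. summable (\<lambda>n. a n * noise n h \<omega>)"
  unfolding AE_all_countable
proof
  fix h
  show "AE \<omega> in M. summable (\<lambda>n. a n * noise n h \<omega>)"
  proof (rule AE_summable_orthogonal[OF measurable_if_history[OF noise_history] noise_bounded _ a])
    fix j k :: nat assume "j < k"
    then have "noise j h \<in> borel_measurable (history M Z I k)"
      using measurable_history_mono[OF _ noise_history, of j k h] by linarith
    then show "expectation (\<lambda>\<omega>. noise j h \<omega> * noise k h \<omega>) = 0"
      by (rule integral_noise[OF _ noise_bounded])
  qed
qed

lemma Z_noise_recursion:
  assumes "\<omega> \<in> space M"
  shows "Z (Suc n) \<omega> $ h
     = Z n \<omega> $ h + r n * ((success (Z n \<omega>) h - Z n \<omega> $ h) + noise n h \<omega>)"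
  by (simp add: Z_Suc[OF assms] noise_def algebra_simps)

lemma Z_component_unit:
  assumes "\<omega> \<in> space M"
  shows "0 \<le> Z n \<omega> $ h" "Z n \<omega> $ h \<le> 1"
  using Z_in_cube[OF assms, of n] by (auto simp: mem_box_cart)

lemma success_component_unit:
  assumes "\<omega> \<in> space M"
  shows "0 \<le> success (Z n \<omega>) h" "success (Z n \<omega>) h \<le> 1"
  using success_unit[OF Z_in_cube[OF assms]] by auto

text \<open>The mean and the constant term cancel in a difference of components, which therefore
  obeys a scalar recursion with 0 as its only candidate limit.\<close>

lemma synchronization:
  assumes \<omega>: "\<omega> \<in> space M" and sum: "\<And>h. summable (\<lambda>n. r n * noise n h \<omega>)"
  shows "(\<lambda>n. Z n \<omega> $ h - Z n \<omega> $ j) \<longlonglongrightarrow> 0"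
proof -
  let ?k = "(1 - \<alpha> - \<beta>) * (2 * \<theta> - 1)"
  define d where "d n = Z n \<omega> $ h - Z n \<omega> $ j" for n
  define b where "b n = (success (Z n \<omega>) h - success (Z n \<omega>) j) - d n" for n
  have b_eq: "b n = (1 - \<alpha> - \<beta>) * (f_theta \<theta> (Z n \<omega> $ h) - f_theta \<theta> (Z n \<omega> $ j)) - d n" for n
    by (simp add: b_def success_def algebra_simps)
  have "\<exists>l\<in>{0}. d \<longlonglongrightarrow> l"
  proof (rule noisy_recursion_limit[where a = r and b = b and B = 2
        and e = "\<lambda>n. noise n h \<omega> - noise n j \<omega>"])
    show "d (Suc n) = d n + r n * (b n + (noise n h \<omega> - noise n j \<omega>))" for n
      unfolding d_def b_def Z_noise_recursion[OF \<omega>] by (simp add: algebra_simps)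
    show "summable (\<lambda>n. r n * (noise n h \<omega> - noise n j \<omega>))"
      using summable_diff[OF sum[of h] sum[of j]] by (simp add: right_diff_distrib)
    show "\<bar>b n\<bar> \<le> 2" for n
      using success_component_unit[OF \<omega>, of n h] success_component_unit[OF \<omega>, of n j]
        Z_component_unit[OF \<omega>, of n h] Z_component_unit[OF \<omega>, of n j]
      unfolding b_def d_def by linarith
    show "Bseq d"
    proof (rule BseqI')
      show "norm (d n) \<le> 1" for n
        using Z_component_unit[OF \<omega>, of n h] Z_component_unit[OF \<omega>, of n j] by (simp add: d_def)
    qed
  next
    fix c :: real assume "c \<notin> {0}"
    then have c: "0 < \<bar>c\<bar>" by simp
    \<comment> \<open>Within distance |c| / 2 of \<open>c\<close> the difference has absolute value
      at least |c| / 2, and the cubic term of \<open>f_theta_contraction\<close> then bounds the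
      push towards 0 from below by this constant.\<close>
    let ?\<eta> = "?k * (\<bar>c\<bar> / 2) ^ 3 / 2"
    have "?\<eta> \<le> - sgn c * b n" if near: "\<bar>d n - c\<bar> < \<bar>c\<bar> / 2" for n
    proof (cases "0 < c")
      case True
      then have d: "\<bar>c\<bar> / 2 \<le> d n" using near by linarith
      then have "Z n \<omega> $ j \<le> Z n \<omega> $ h" unfolding d_def using c by linarith
      from f_theta_contraction[OF less_imp_le[OF gain_pos] gain_le this]
      have "?k * d n ^ 3 / 2 \<le> - b n" unfolding b_eq d_def by linarith
      moreover have "?k * (\<bar>c\<bar> / 2) ^ 3 \<le> ?k * d n ^ 3"
        using d by (intro mult_left_mono power_mono less_imp_le[OF gain_pos]) auto
      ultimately show ?thesis using True by simp
    next
      case False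
      then have d: "\<bar>c\<bar> / 2 \<le> - d n" using near by linarith
      then have "Z n \<omega> $ h \<le> Z n \<omega> $ j" unfolding d_def using c by linarith
      from f_theta_contraction[OF less_imp_le[OF gain_pos] gain_le this]
      have "?k * (- d n) ^ 3 / 2 \<le> b n" unfolding b_eq d_def by (simp add: algebra_simps)
      moreover have "?k * (\<bar>c\<bar> / 2) ^ 3 \<le> ?k * (- d n) ^ 3"
        using d by (intro mult_left_mono power_mono less_imp_le[OF gain_pos]) auto
      moreover have "sgn c = -1" using False c by simp
      ultimately show ?thesis by simp
    qed
    moreover have "0 < ?\<eta>" using c gain_pos by simp
    moreover have "- sgn c \<in> {1, -1}" using c by (auto simp: sgn_if)
    ultimately show "\<exists>\<delta>>0. \<exists>\<eta>>0. \<exists>s\<in>{1, -1}. \<forall>\<^sub>F n in sequentially. \<bar>d n - c\<bar> < \<delta> \<longrightarrow> \<eta> \<le> s * b n"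
      using c by (intro exI[of _ "\<bar>c\<bar> / 2"] exI[of _ ?\<eta>] bexI[of _ "- sgn c"] conjI always_eventually) auto
  qed (use r_nonneg r_tendsto_0 not_summable_r in auto)
  then show ?thesis unfolding d_def by simp
qed

text \<open>By synchronisation the mean may be replaced by one reference component up to an error
  tending to 0, which leaves the scalar drift.\<close>

lemma component_limit:
  assumes \<omega>: "\<omega> \<in> space M" and sum: "\<And>h. summable (\<lambda>n. r n * noise n h \<omega>)"
  shows "\<exists>\<zeta>\<in>{0..1}. diag_drift \<alpha> \<beta> q \<theta> \<zeta> = 0 \<and> (\<forall>h. (\<lambda>n. Z n \<omega> $ h) \<longlonglongrightarrow> \<zeta>)"
proof -
  fix h0 :: 'n
  define x where "x n = Z n \<omega> $ h0" for n
  have sync: "(\<lambda>n. Z n \<omega> $ h - x n) \<longlonglongrightarrow> 0" for h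
    unfolding x_def by (rule synchronization[OF \<omega> sum])
  have "(\<lambda>n. \<alpha> * ((\<Sum>h\<in>UNIV. Z n \<omega> $ h - x n) / real CARD('n))) \<longlonglongrightarrow> \<alpha> * ((\<Sum>h\<in>(UNIV :: 'n set). 0) / real CARD('n))"
    by (intro tendsto_intros sync) simp
  moreover have "(\<Sum>h\<in>UNIV. Z n \<omega> $ h - x n) / real CARD('n) = mean (Z n \<omega>) - x n" for n
    by (simp add: mean_def sum_subtractf field_simps)
  ultimately have err: "(\<lambda>n. \<alpha> * (mean (Z n \<omega>) - x n)) \<longlonglongrightarrow> 0" by simp
  define b where "b n = success (Z n \<omega>) h0 - x n" for n
  have b_eq: "b n = diag_drift \<alpha> \<beta> q \<theta> (x n) + \<alpha> * (mean (Z n \<omega>) - x n)" for n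
    by (simp add: b_def x_def success_def diag_drift_def algebra_simps)
  have "\<exists>\<zeta>\<in>{x. diag_drift \<alpha> \<beta> q \<theta> x = 0}. x \<longlonglongrightarrow> \<zeta>"
  proof (rule noisy_recursion_limit[where a = r and b = b and B = 1 and e = "\<lambda>n. noise n h0 \<omega>"])
    show "x (Suc n) = x n + r n * (b n + noise n h0 \<omega>)" for n
      unfolding x_def b_def by (rule Z_noise_recursion[OF \<omega>])
    show "\<bar>b n\<bar> \<le> 1" for n
      using success_component_unit[OF \<omega>, of n h0] Z_component_unit[OF \<omega>, of n h0]
      unfolding b_def x_def by linarith
    show "Bseq x"
    proof (rule BseqI')
      show "norm (x n) \<le> 1" for n using Z_component_unit[OF \<omega>, of n h0] by (simp add: x_def)
    qed
  next
    fix c :: real assume "c \<notin> {x. diag_drift \<alpha> \<beta> q \<theta> x = 0}"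
    define D where "D = diag_drift \<alpha> \<beta> q \<theta> c"
    \<comment> \<open>One third of |D| is spent on the variation of the drift near \<open>c\<close>
      and one third on the error from the mean; the last third remains as the push.\<close>
    have D: "0 < \<bar>D\<bar> / 3" using \<open>c \<notin> _\<close> by (simp add: D_def)
    have "isCont (diag_drift \<alpha> \<beta> q \<theta>) c"
      unfolding diag_drift_def[abs_def] f_theta_def by (intro continuous_intros)
    then obtain \<delta> where \<delta>: "\<delta> > 0" "\<And>y. \<bar>y - c\<bar> < \<delta> \<Longrightarrow> \<bar>diag_drift \<alpha> \<beta> q \<theta> y - D\<bar> < \<bar>D\<bar> / 3"
      using D unfolding continuous_at_eps_delta dist_real_def D_def by blast
    have "\<forall>\<^sub>F n in sequentially. \<bar>\<alpha> * (mean (Z n \<omega>) - x n)\<bar> < \<bar>D\<bar> / 3"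
      using tendstoD[OF err D] by (simp add: dist_real_def)
    then have "\<forall>\<^sub>F n in sequentially. \<bar>x n - c\<bar> < \<delta> \<longrightarrow> \<bar>D\<bar> / 3 \<le> sgn D * b n"
    proof eventually_elim
      case (elim n)
      show ?case
      proof
        assume "\<bar>x n - c\<bar> < \<delta>"
        from \<delta>(2)[OF this] have "\<bar>b n - D\<bar> \<le> 2 / 3 * \<bar>D\<bar>"
          using elim unfolding b_eq by argo
        then show "\<bar>D\<bar> / 3 \<le> sgn D * b n" by (auto simp: sgn_if abs_if split: if_splits)
      qed
    qed
    moreover have "sgn D \<in> {1, -1}" using D by (auto simp: sgn_if)
    ultimately show "\<exists>\<delta>>0. \<exists>\<eta>>0. \<exists>s\<in>{1, -1}. \<forall>\<^sub>F n in sequentially. \<bar>x n - c\<bar> < \<delta> \<longrightarrow> \<eta> \<le> s * b n"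
      using \<delta>(1) D by blast
  qed (use r_nonneg r_tendsto_0 not_summable_r sum finite_diag_drift_zeros[OF gain_pos] in auto)
  then obtain \<zeta> where \<zeta>: "diag_drift \<alpha> \<beta> q \<theta> \<zeta> = 0" "x \<longlonglongrightarrow> \<zeta>" by blast
  have "0 \<le> \<zeta>" "\<zeta> \<le> 1"
    using Z_component_unit[OF \<omega>, of _ h0] LIMSEQ_le_const[OF \<zeta>(2), of 0] LIMSEQ_le_const2[OF \<zeta>(2), of 1]
    unfolding x_def by auto
  moreover have "(\<lambda>n. Z n \<omega> $ h) \<longlonglongrightarrow> \<zeta>" for h
    using tendsto_add[OF sync[of h] \<zeta>(2)] by simp
  ultimately show ?thesis using \<zeta>(1) by auto
qed

lemma success_tendsto:
  assumes "\<And>h. (\<lambda>n. Z n \<omega> $ h) \<longlonglongrightarrow> \<zeta>" "diag_drift \<alpha> \<beta> q \<theta> \<zeta> = 0"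
  shows "(\<lambda>n. success (Z n \<omega>) h) \<longlonglongrightarrow> \<zeta>"
proof -
  have "(\<lambda>n. \<alpha> * ((\<Sum>h\<in>UNIV. Z n \<omega> $ h) / real CARD('n)) + \<beta> * q + (1 - \<alpha> - \<beta>) *
      ((1 - \<theta>) + (2 * \<theta> - 1) * (3 * (Z n \<omega> $ h) ^ 2 - 2 * (Z n \<omega> $ h) ^ 3)))
    \<longlonglongrightarrow> \<alpha> * ((\<Sum>h\<in>(UNIV :: 'n set). \<zeta>) / real CARD('n)) + \<beta> * q + (1 - \<alpha> - \<beta>) *
      ((1 - \<theta>) + (2 * \<theta> - 1) * (3 * \<zeta> ^ 2 - 2 * \<zeta> ^ 3))"
    by (intro tendsto_intros assms(1)) simp
  moreover have "\<alpha> * ((\<Sum>h\<in>(UNIV :: 'n set). \<zeta>) / real CARD('n)) + \<beta> * q + (1 - \<alpha> - \<beta>) *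
      ((1 - \<theta>) + (2 * \<theta> - 1) * (3 * \<zeta> ^ 2 - 2 * \<zeta> ^ 3)) = \<zeta>"
    using assms(2) by (simp add: diag_drift_def f_theta_def)
  ultimately show ?thesis by (simp add: success_def mean_def f_theta_def)
qed

text \<open>The empirical mean satisfies the same kind of recursion, with step sizes \<open>1/(n+1)\<close> and a drift
  towards \<open>\<zeta>\<close>.\<close>

lemma empirical_mean_limit:
  assumes \<omega>: "\<omega> \<in> space M" and sum: "summable (\<lambda>n. 1 / real (Suc n) * noise n h \<omega>)"
    and lim: "(\<lambda>n. success (Z n \<omega>) h) \<longlonglongrightarrow> \<zeta>"
  shows "(\<lambda>n. 1 / real n * (\<Sum>k = 1..n. I k \<omega> $ h)) \<longlonglongrightarrow> \<zeta>"
proof -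
  define x where "x n = 1 / real n * (\<Sum>k = 1..n. I k \<omega> $ h)" for n
  define b where "b n = success (Z n \<omega>) h - x n" for n
  have x_unit: "0 \<le> x n" "x n \<le> 1" for n
  proof -
    have I: "0 \<le> I k \<omega> $ h" "I k \<omega> $ h \<le> 1" if "k \<in> {1..n}" for k
      using I_range[OF \<omega>, of "k - 1" h] that by auto
    then show "0 \<le> x n" by (auto simp: x_def intro!: divide_nonneg_nonneg sum_nonneg)
    have "(\<Sum>k = 1..n. I k \<omega> $ h) \<le> (\<Sum>k = 1..n. 1)" using I by (intro sum_mono) auto
    then show "x n \<le> 1" by (simp add: x_def divide_le_eq)
  qed
  have "\<exists>l\<in>{\<zeta>}. x \<longlonglongrightarrow> l"
  proof (rule noisy_recursion_limit[where a = "\<lambda>n. 1 / real (Suc n)" and b = b and B = 1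
        and e = "\<lambda>n. noise n h \<omega>"])
    show "x (Suc n) = x n + 1 / real (Suc n) * (b n + noise n h \<omega>)" for n
    proof -
      \<comment> \<open>At \<open>m = 0\<close> both sides are 0, so the recursion is valid from the
        first draw on.\<close>
      have x: "real m * x m = (\<Sum>k = 1..m. I k \<omega> $ h)" for m by (simp add: x_def)
      have "real (Suc n) * x (Suc n) = real n * x n + I (Suc n) \<omega> $ h" unfolding x by simp
      also have "\<dots> = real (Suc n) * x n + (I (Suc n) \<omega> $ h - x n)" by (simp add: algebra_simps)
      also have "\<dots> = real (Suc n) * (x n + 1 / real (Suc n) * (b n + noise n h \<omega>))"
        by (simp add: b_def noise_def distrib_left del: of_nat_Suc)
      finally show ?thesis by (simp del: of_nat_Suc)
    qed
    show "(\<lambda>n. 1 / real (Suc n)) \<longlonglongrightarrow> 0"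
      using LIMSEQ_Suc[OF lim_const_over_n[of 1]] by simp
    show "\<not> summable (\<lambda>n. 1 / real (Suc n))"
      using not_summable_harmonic[where 'a = real] summable_Suc_iff[of "\<lambda>n. inverse (real n)"]
      by (simp add: inverse_eq_divide)
    show "\<bar>b n\<bar> \<le> 1" for n
      using success_component_unit[OF \<omega>, of n h] x_unit[of n] unfolding b_def by linarith
    show "Bseq x"
    proof (rule BseqI')
      show "norm (x n) \<le> 1" for n using x_unit[of n] by simp
    qed
  next
    fix c :: real assume "c \<notin> {\<zeta>}"
    define D where "D = \<zeta> - c"
    have D: "0 < \<bar>D\<bar> / 3" using \<open>c \<notin> {\<zeta>}\<close> by (simp add: D_def)
    have "\<forall>\<^sub>F n in sequentially. \<bar>success (Z n \<omega>) h - \<zeta>\<bar> < \<bar>D\<bar> / 3"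
      using tendstoD[OF lim D] by (simp add: dist_real_def)
    then have "\<forall>\<^sub>F n in sequentially. \<bar>x n - c\<bar> < \<bar>D\<bar> / 3 \<longrightarrow> \<bar>D\<bar> / 3 \<le> sgn D * b n"
    proof eventually_elim
      case (elim n)
      show ?case
      proof
        assume "\<bar>x n - c\<bar> < \<bar>D\<bar> / 3"
        then have "\<bar>b n - D\<bar> \<le> 2 / 3 * \<bar>D\<bar>"
          using elim unfolding b_def D_def by argo
        then show "\<bar>D\<bar> / 3 \<le> sgn D * b n" by (auto simp: sgn_if abs_if split: if_splits)
      qed
    qed
    moreover have "sgn D \<in> {1, -1}" using D by (auto simp: sgn_if)
    ultimately show "\<exists>\<delta>>0. \<exists>\<eta>>0. \<exists>s\<in>{1, -1}. \<forall>\<^sub>F n in sequentially. \<bar>x n - c\<bar> < \<delta> \<longrightarrow> \<eta> \<le> s * b n"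
      using D by blast
  qed (use sum in auto)
  then show ?thesis unfolding x_def by simp
qed

section \<open>From single paths to the random limit\<close>

definition stable_limits :: "real set" where
  "stable_limits = {x \<in> {0..1}. diag_drift \<alpha> \<beta> q \<theta> x = 0 \<and> diag_slope \<alpha> \<beta> \<theta> x \<le> 0}"

definition good :: "'a \<Rightarrow> bool" where
  "good \<omega> \<longleftrightarrow> (\<exists>\<zeta>\<in>stable_limits. \<forall>h. (\<lambda>n. Z n \<omega> $ h) \<longlonglongrightarrow> \<zeta> \<and>
      (\<lambda>n. 1 / real n * (\<Sum>k = 1..n. I k \<omega> $ h)) \<longlonglongrightarrow> \<zeta>)"

text \<open>There are only finitely many unstable zeros, so almost surely none of them is the limit,
  and the zero found by \<open>component_limit\<close> must be a stable one.\<close>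

lemma AE_good: "AE \<omega> in M. good \<omega>"
proof -
  obtain C where C: "\<And>n. r n \<le> C / real (Suc n)" by (rule r_bound) (rule that; blast)
  have noise_r: "AE \<omega> in M. \<forall>h. summable (\<lambda>n. r n * noise n h \<omega>)"
    by (rule AE_noise_summable[OF r_nonneg C])
  have noise_n: "AE \<omega> in M. \<forall>h. summable (\<lambda>n. 1 / real (Suc n) * noise n h \<omega>)"
    by (rule AE_noise_summable[of _ 1]) auto
  let ?Z = "{x. diag_drift \<alpha> \<beta> q \<theta> x = 0 \<and> 0 < diag_slope \<alpha> \<beta> \<theta> x}"
  have "finite ?Z" by (rule finite_subset[OF _ finite_diag_drift_zeros[OF gain_pos, of q]]) auto
  then have unstable: "AE \<omega> in M. \<forall>u\<in>?Z. \<not> (\<forall>h. (\<lambda>n. Z n \<omega> $ h) \<longlonglongrightarrow> u)"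
    by (intro AE_finite_allI AE_not_tendsto_unstable) auto
  from noise_r noise_n unstable show ?thesis
  proof (rule AE_mp[OF AE_conjI[OF _ AE_conjI]], intro AE_I2 impI)
    fix \<omega> assume \<omega>: "\<omega> \<in> space M"
      and "(\<forall>h. summable (\<lambda>n. r n * noise n h \<omega>)) \<and>
        (\<forall>h. summable (\<lambda>n. 1 / real (Suc n) * noise n h \<omega>)) \<and>
        (\<forall>u\<in>?Z. \<not> (\<forall>h. (\<lambda>n. Z n \<omega> $ h) \<longlonglongrightarrow> u))"
    then have sums: "\<And>h. summable (\<lambda>n. r n * noise n h \<omega>)"
        "\<And>h. summable (\<lambda>n. 1 / real (Suc n) * noise n h \<omega>)"
      and no: "\<And>u. u \<in> ?Z \<Longrightarrow> \<not> (\<forall>h. (\<lambda>n. Z n \<omega> $ h) \<longlonglongrightarrow> u)" by blast+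
    from component_limit[OF \<omega> sums(1)] obtain \<zeta> where
      \<zeta>: "\<zeta> \<in> {0..1}" "diag_drift \<alpha> \<beta> q \<theta> \<zeta> = 0" "\<And>h. (\<lambda>n. Z n \<omega> $ h) \<longlonglongrightarrow> \<zeta>" by blast
    have "diag_slope \<alpha> \<beta> \<theta> \<zeta> \<le> 0" using no[of \<zeta>] \<zeta>(2,3) by force
    then have "\<zeta> \<in> stable_limits" using \<zeta> by (simp add: stable_limits_def)
    moreover have "(\<lambda>n. 1 / real n * (\<Sum>k = 1..n. I k \<omega> $ h)) \<longlonglongrightarrow> \<zeta>" for h
      by (rule empirical_mean_limit[OF \<omega> sums(2) success_tendsto[OF \<zeta>(3,2)]])
    ultimately show "good \<omega>" unfolding good_def using \<zeta>(3) by blast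
  qed
qed

lemma stable_zero_points_eq:
  "stable_zero_points (drift \<alpha> \<beta> q (f_theta \<theta>) :: real ^ 'n \<Rightarrow> real ^ 'n) = (\<lambda>x. x *\<^sub>R 1) ` stable_limits"
  unfolding stable_limits_def
  by (rule stable_zero_points_diag[OF refl gain_pos gain_le alpha(1)])

text \<open>The scalar drift is at least \<open>(1 - \<alpha> - \<beta>) * (1 - \<theta>)\<close> at
  0 and at most the negative of this number at 1, so no endpoint is a zero.\<close>

lemma stable_limits_interior: "stable_limits \<subseteq> {0<..<1}"
proof
  fix x assume "x \<in> stable_limits"
  then have x: "x \<in> {0..1}" "diag_drift \<alpha> \<beta> q \<theta> x = 0" by (auto simp: stable_limits_def)
  have p: "0 < (1 - \<alpha> - \<beta>) * (1 - \<theta>)" using gamma_pos theta by simp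
  have "0 < diag_drift \<alpha> \<beta> q \<theta> 0"
    using p beta(1) q(1) by (simp add: diag_drift_def f_theta_def add_nonneg_pos)
  moreover have "diag_drift \<alpha> \<beta> q \<theta> 1 < 0"
    using p mult_left_le[OF q(2) beta(1)] by (simp add: diag_drift_def f_theta_def algebra_simps)
  ultimately have "x \<noteq> 0" "x \<noteq> 1" using x(2) by auto
  then show "x \<in> {0<..<1}" using x(1) by auto
qed

text \<open>The limit has to be a stable zero at every point of the space, not only almost
  everywhere. On a measurable null set containing all exceptional paths it is therefore set to a
  fixed stable zero.\<close>

lemma random_limit:
  "\<exists>Zinf :: 'a \<Rightarrow> real. Zinf \<in> borel_measurable M \<and>
     (AE \<omega> in M. (\<lambda>n. Z n \<omega>) \<longlonglongrightarrow> Zinf \<omega> *\<^sub>R 1) \<and>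
     (AE \<omega> in M. (\<lambda>n. (1 / real n) *\<^sub>R (\<Sum>k=1..n. I k \<omega>)) \<longlonglongrightarrow> Zinf \<omega> *\<^sub>R 1) \<and>
     (\<forall>\<omega>\<in>space M. Zinf \<omega> \<in> stable_limits)"
proof -
  fix h0 :: 'n
  obtain N where N: "N \<in> null_sets M" "{\<omega> \<in> space M. \<not> good \<omega>} \<subseteq> N"
    using AE_good unfolding eventually_ae_filter by auto
  have good: "good \<omega>" if "\<omega> \<in> space M" "\<omega> \<notin> N" for \<omega> using N(2) that by blast
  \<comment> \<open>A null set cannot exhaust a probability space, so a good path exists, and with
    it a stable zero to serve as the default value.\<close>
  have "N \<noteq> space M" using N(1) emeasure_space_1 by auto
  moreover have "N \<subseteq> space M" using N(1) sets.sets_into_space by blast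
  ultimately obtain \<omega>0 where "\<omega>0 \<in> space M" "\<omega>0 \<notin> N" by blast
  then obtain x0 where x0: "x0 \<in> stable_limits" using good by (auto simp: good_def)
  define Zinf where "Zinf \<omega> = (if \<omega> \<in> N then x0 else lim (\<lambda>n. Z n \<omega> $ h0))" for \<omega>
  have Zinf: "Zinf \<omega> \<in> stable_limits \<and> (\<forall>h. (\<lambda>n. Z n \<omega> $ h) \<longlonglongrightarrow> Zinf \<omega> \<and>
      (\<lambda>n. 1 / real n * (\<Sum>k = 1..n. I k \<omega> $ h)) \<longlonglongrightarrow> Zinf \<omega>)"
    if \<omega>: "\<omega> \<in> space M" "\<omega> \<notin> N" for \<omega>
  proof -
    obtain \<zeta> where \<zeta>: "\<zeta> \<in> stable_limits" "\<forall>h. (\<lambda>n. Z n \<omega> $ h) \<longlonglongrightarrow> \<zeta> \<and>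
        (\<lambda>n. 1 / real n * (\<Sum>k = 1..n. I k \<omega> $ h)) \<longlonglongrightarrow> \<zeta>"
      using good[OF \<omega>] unfolding good_def by blast
    then have "lim (\<lambda>n. Z n \<omega> $ h0) = \<zeta>" using limI by blast
    then have "Zinf \<omega> = \<zeta>" using \<omega>(2) by (simp add: Zinf_def)
    then show ?thesis using \<zeta> by blast
  qed
  have vec_lim: "X \<longlonglongrightarrow> x *\<^sub>R (1 :: real ^ 'n)" if "\<And>h. (\<lambda>n. X n $ h) \<longlonglongrightarrow> x" for X x
    using that by (intro vec_tendstoI) simp
  have off_N: "AE \<omega> in M. \<omega> \<notin> N" by (rule AE_not_in[OF N(1)])
  show ?thesis
  proof (intro exI[of _ Zinf] conjI ballI)
    have "(\<lambda>\<omega>. lim (\<lambda>n. Z n \<omega> $ h0)) \<in> borel_measurable M"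
      by (rule borel_measurable_lim_metric) (rule measurable_if_history[OF Z_component_history])
    then show "Zinf \<in> borel_measurable M"
      unfolding Zinf_def using N(1) by (intro measurable_If_set) auto
    show "AE \<omega> in M. (\<lambda>n. Z n \<omega>) \<longlonglongrightarrow> Zinf \<omega> *\<^sub>R 1"
      using off_N by (rule AE_mp, intro AE_I2 impI vec_lim) (use Zinf in blast)
    show "AE \<omega> in M. (\<lambda>n. (1 / real n) *\<^sub>R (\<Sum>k=1..n. I k \<omega>)) \<longlonglongrightarrow> Zinf \<omega> *\<^sub>R 1"
    proof (rule AE_mp[OF off_N], intro AE_I2 impI vec_lim)
      fix \<omega> h assume "\<omega> \<in> space M" "\<omega> \<notin> N"
      then have "(\<lambda>n. 1 / real n * (\<Sum>k = 1..n. I k \<omega> $ h)) \<longlonglongrightarrow> Zinf \<omega>" using Zinf by blast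
      then show "(\<lambda>n. ((1 / real n) *\<^sub>R (\<Sum>k=1..n. I k \<omega>)) $ h) \<longlonglongrightarrow> Zinf \<omega>"
        by (simp add: sum_component)
    qed
    show "Zinf \<omega> \<in> stable_limits" if "\<omega> \<in> space M" for \<omega>
      using Zinf[OF that] x0 by (cases "\<omega> \<in> N") (auto simp: Zinf_def)
  qed
qed

end

theorem theorem3p17:
  fixes M :: "'a measure"
    and \<alpha> \<beta> q \<theta> :: real
    and r :: "nat \<Rightarrow> real"
    and Z I :: "nat \<Rightarrow> 'a \<Rightarrow> real ^ 'n::finite"
  defines "F \<equiv> (drift \<alpha> \<beta> q (f_theta \<theta>) :: real ^ 'n \<Rightarrow> real ^ 'n)"
  assumes "reinforced_system M \<alpha> \<beta> q (f_theta \<theta>) r Z I"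
    and "1 / 2 < \<theta>" and "\<theta> < 1"
    and "3 * \<theta> - 3 / 2 \<le> 1 / (1 - \<alpha> - \<beta>)"
  shows "(\<exists>Zinf :: 'a \<Rightarrow> real.
            Zinf \<in> borel_measurable M \<and>
            (AE \<omega> in M. (\<lambda>n. Z n \<omega>) \<longlonglongrightarrow> Zinf \<omega> *\<^sub>R 1) \<and>
            (AE \<omega> in M. (\<lambda>n. (1 / real n) *\<^sub>R (\<Sum>k=1..n. I k \<omega>)) \<longlonglongrightarrow> Zinf \<omega> *\<^sub>R 1) \<and>
            (\<forall>\<omega>\<in>space M. Zinf \<omega> *\<^sub>R 1 \<in> stable_zero_points F)) \<and>
         stable_zero_points F \<subseteq> box 0 1 \<and>
         finite (stable_zero_points F) \<and>
         card (stable_zero_points F) \<le> 2"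
proof -
  interpret reinforced_system M \<alpha> \<beta> q "f_theta \<theta>" r Z I by (rule assms(2))
  interpret theta_system M \<alpha> \<beta> q \<theta> r Z I by unfold_locales (rule assms(3-5))+
  have S: "stable_zero_points F = (\<lambda>x. x *\<^sub>R 1) ` stable_limits"
    unfolding F_def by (rule stable_zero_points_eq)
  have "stable_limits \<subseteq> {x. diag_drift \<alpha> \<beta> q \<theta> x = 0 \<and> diag_slope \<alpha> \<beta> \<theta> x \<le> 0}"
    by (auto simp: stable_limits_def)
  then have fin: "finite stable_limits" "card stable_limits \<le> 2"
    using stable_diag_zeros_card[OF gain_pos, of q] card_mono
    by (meson finite_subset, meson card_mono order_trans)
  have "stable_zero_points F \<subseteq> box 0 1"
    unfolding S using stable_limits_interior by (auto simp: mem_box_cart)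
  moreover have "finite (stable_zero_points F)" unfolding S using fin(1) by simp
  moreover have "card (stable_zero_points F) \<le> 2"
    unfolding S using card_image_le[OF fin(1)] fin(2) order_trans by blast
  moreover obtain Zinf where "Zinf \<in> borel_measurable M"
    "AE \<omega> in M. (\<lambda>n. Z n \<omega>) \<longlonglongrightarrow> Zinf \<omega> *\<^sub>R 1"
    "AE \<omega> in M. (\<lambda>n. (1 / real n) *\<^sub>R (\<Sum>k=1..n. I k \<omega>)) \<longlonglongrightarrow> Zinf \<omega> *\<^sub>R 1"
    "\<forall>\<omega>\<in>space M. Zinf \<omega> \<in> stable_limits"
    using random_limit by blast
  moreover from this(4) have "\<forall>\<omega>\<in>space M. Zinf \<omega> *\<^sub>R 1 \<in> stable_zero_points F"
    unfolding S by blast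
  ultimately show ?thesis by blast
qed

end
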